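(* Let $x^\ast,X^\ast\in\mathbb R^n$. In the Dirichlet problem $$x=x^\ast,\qquad \phi^X_\mu(x,y)=X^\ast$$ for a smooth family of symplectic maps $\phi_\mu\colon\mathbb R^{2n}\to\mathbb R^{2n}$, only those singularities occur which can be obtained in the gradient-zero-problem $\nabla g_\mu=0$ for a smooth family of smooth maps $g_\mu\colon\mathbb R^k\to\mathbb R$ with $k\le n$.
   Context: $\mathbb R^{2n}$ has coordinates $(x,y)=(x^1,\dots,x^n,y_1,\dots,y_n)$ and symplectic form $\omega=\sum_j\mathrm dx^j\wedge\mathrm dy_j$; $\phi_\mu^X,\phi_\mu^Y$ are the $x$- and $y$-components of $\phi_\mu$; $\mu$ ranges over an open subset of some $\mathbb R^p$. Translation to functions: $T^\ast\mathbb R^{2n}$ has coordinates $(q,p)$, $q,p\in\mathbb R^{2n}$, with symplectic form $\sum_i\mathrm dp_i\wedge\mathrm dq^i$. The Lagrangian submanifold $\Gamma_\mu$ is the image of $\iota_\mu(x,y)=(x,\phi^Y_\mu(x,y),y,\phi^X_\mu(x,y))$ (first $2n$ entries are $q$, last $2n$ entries are $p$) and the Dirichlet condition is the Lagrangian submanifold $\Lambda=\{(x^\ast,Y,y,X^\ast):y,Y\in\mathbb R^n\}$; solutions correspond to points of $\Gamma_\mu\cap\Lambda$. Near $\mu^\ast$ and $z^\ast\in\Gamma_{\mu^\ast}\cap\Lambda$, after a local symplectomorphism fixing $z^\ast$ both manifolds become images of exact 1-forms, $\Gamma_\mu=\mathrm df_\mu(U)$, $\Lambda=\mathrm dg(U)$,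 on an open $U\subset\mathbb R^{2n}$, and with $h_\mu=f_\mu-g$ the solutions correspond to critical points of $h_\mu$. The singularity occurring at $(\mu^\ast,z^\ast)$ is the germ of $h_{\mu^\ast}$ at the corresponding critical point together with its unfolding $(h_\mu)_\mu$. Singularities are considered up to stable equivalence: the singularity can be obtained with $k$ variables if, after a smooth $\mu$-dependent family of local diffeomorphisms of the domain and up to adding a function of $\mu$ only, $h_\mu(t_1,\dots,t_{2n})=g_\mu(t_1,\dots,t_k)+Q(t_{k+1},\dots,t_{2n})$ locally, with a smooth family $(g_\mu)$ and a nondegenerate quadratic form $Q$. *)

theory Defs
  imports "HOL-Analysis.Analysis"
begin

(* All directional derivatives of order at most n exist and are continuous. Only meant
   for open S, since frechet_derivative is taken with respect to the whole space. *)
fun differentiable_order_on ::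
  "nat \<Rightarrow> 'a::real_normed_vector set \<Rightarrow> ('a \<Rightarrow> 'b::real_normed_vector) \<Rightarrow> bool" where
  "differentiable_order_on 0 S f \<longleftrightarrow> continuous_on S f"
| "differentiable_order_on (Suc n) S f \<longleftrightarrow>
     (\<forall>x\<in>S. f differentiable (at x)) \<and>
     (\<forall>v. differentiable_order_on n S (\<lambda>x. frechet_derivative f (at x) v))"

definition smooth_on ::
  "'a::real_normed_vector set \<Rightarrow> ('a \<Rightarrow> 'b::real_normed_vector) \<Rightarrow> bool" where
  "smooth_on S f \<longleftrightarrow> open S \<and> (\<forall>n. differentiable_order_on n S f)"

(* Smooth families: smoothness is joint in the parameter and the variable. *)
definition smooth_family_on ::
  "'m::real_normed_vector set \<Rightarrow> 'a::real_normed_vector set \<Rightarrow>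
   ('m \<Rightarrow> 'a \<Rightarrow> 'b::real_normed_vector) \<Rightarrow> bool" where
  "smooth_family_on M S F \<longleftrightarrow> smooth_on (M \<times> S) (\<lambda>(\<mu>, z). F \<mu> z)"

definition diffeomorphism_onto_open_image ::
  "'a::real_normed_vector set \<Rightarrow> ('a \<Rightarrow> 'b::real_normed_vector) \<Rightarrow> bool" where
  "diffeomorphism_onto_open_image W f \<longleftrightarrow>
     smooth_on W f \<and> (\<exists>g. smooth_on (f ` W) g \<and> (\<forall>z\<in>W. g (f z) = z))"

definition preserves_form ::
  "('a::real_normed_vector \<Rightarrow> 'a \<Rightarrow> real) \<Rightarrow> 'a set \<Rightarrow> ('a \<Rightarrow> 'a) \<Rightarrow> bool" where
  "preserves_form \<Omega> W f \<longleftrightarrow>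
     (\<forall>z\<in>W. \<forall>u v. \<Omega> (frechet_derivative f (at z) u) (frechet_derivative f (at z) v) = \<Omega> u v)"

definition form_dx_dy :: "'a::real_inner \<times> 'a \<Rightarrow> 'a \<times> 'a \<Rightarrow> real" where
  "form_dx_dy u v = fst u \<bullet> snd v - snd u \<bullet> fst v"

definition form_dp_dq :: "'a::real_inner \<times> 'a \<Rightarrow> 'a \<times> 'a \<Rightarrow> real" where
  "form_dp_dq u v = snd u \<bullet> fst v - fst u \<bullet> snd v"

definition smooth_symplectic_family ::
  "'m::real_normed_vector set \<Rightarrow> ('m \<Rightarrow> 'a::real_inner \<times> 'a \<Rightarrow> 'a \<times> 'a) \<Rightarrow> bool" where
  "smooth_symplectic_family M \<phi> \<longleftrightarrow>
     smooth_family_on M UNIV \<phi> \<and> (\<forall>\<mu>\<in>M. preserves_form form_dx_dy UNIV (\<phi> \<mu>))"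

(* Points of the cotangent bundle of 'a \<times> 'a are pairs (q, p); covectors are identified with
   vectors through the standard inner product, i.e. by their coordinates. *)
definition \<Gamma> :: "('a \<times> 'a \<Rightarrow> 'a \<times> 'a) \<Rightarrow> (('a \<times> 'a) \<times> ('a \<times> 'a)) set" where
  "\<Gamma> \<phi> = range (\<lambda>(x, y). ((x, snd (\<phi> (x, y))), (y, fst (\<phi> (x, y)))))"

definition Dirichlet :: "'a \<Rightarrow> 'a \<Rightarrow> (('a \<times> 'a) \<times> ('a \<times> 'a)) set" where
  "Dirichlet xs Xs = {((xs, Y), (y, Xs)) | y Y. True}"

definition exact_form_image :: "('a::real_inner \<Rightarrow> real) \<Rightarrow> 'a set \<Rightarrow> ('a \<times> 'a) set" where
  "exact_form_image f U = {(q, p). q \<in> U \<and> GDERIV f q :> p}"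

definition local_symplectomorphism_on ::
  "('a::real_inner \<times> 'a) set \<Rightarrow> ('a \<times> 'a \<Rightarrow> 'a \<times> 'a) \<Rightarrow> bool" where
  "local_symplectomorphism_on W \<Psi> \<longleftrightarrow>
     diffeomorphism_onto_open_image W \<Psi> \<and> preserves_form form_dp_dq W \<Psi>"

(* The unfolding h represents the singularity of the Dirichlet problem at the parameter \<mu>s and
   the solution zs. The corresponding critical point of h \<mu>s is fst zs, as \<Psi> fixes zs. Values of
   h outside N \<times> U are unconstrained: only the germ of h at (\<mu>s, fst zs) matters. *)
definition Dirichlet_singularity ::
  "'m::real_normed_vector set \<Rightarrow> ('m \<Rightarrow> 'a::real_inner \<times> 'a \<Rightarrow> 'a \<times> 'a) \<Rightarrow> 'a \<Rightarrow> 'a \<Rightarrow>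
   'm \<Rightarrow> ('a \<times> 'a) \<times> ('a \<times> 'a) \<Rightarrow> ('m \<Rightarrow> 'a \<times> 'a \<Rightarrow> real) \<Rightarrow> bool" where
  "Dirichlet_singularity M \<phi> xs Xs \<mu>s zs h \<longleftrightarrow>
     \<mu>s \<in> M \<and> zs \<in> \<Gamma> (\<phi> \<mu>s) \<inter> Dirichlet xs Xs \<and>
     (\<exists>N W \<Psi> U f g.
        open N \<and> \<mu>s \<in> N \<and> N \<subseteq> M \<and>
        zs \<in> W \<and> local_symplectomorphism_on W \<Psi> \<and> \<Psi> zs = zs \<and>
        open U \<and> smooth_family_on N U f \<and> smooth_on U g \<and>
        (\<forall>\<mu>\<in>N. \<Psi> ` (\<Gamma> (\<phi> \<mu>) \<inter> W) = exact_form_image (f \<mu>) U) \<and>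
        \<Psi> ` (Dirichlet xs Xs \<inter> W) = exact_form_image g U \<and>
        (\<forall>\<mu>\<in>N. \<forall>q\<in>U. h \<mu> q = f \<mu> q - g q))"

definition coordinate_part :: "'a::euclidean_space set \<Rightarrow> 'a \<Rightarrow> 'a" where
  "coordinate_part K t = (\<Sum>b\<in>K. (t \<bullet> b) *\<^sub>R b)"

definition nondegenerate_quadratic_form_on ::
  "'a::real_vector set \<Rightarrow> ('a \<Rightarrow> real) \<Rightarrow> bool" where
  "nondegenerate_quadratic_form_on V Q \<longleftrightarrow>
     (\<exists>B :: 'a \<Rightarrow> 'a \<Rightarrow> real. bilinear B \<and> (\<forall>v w. B v w = B w v) \<and> (\<forall>v. Q v = B v v) \<and>
        (\<forall>v\<in>V. (\<forall>w\<in>V. B v w = 0) \<longrightarrow> v = 0))"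

(* The unfolding h of the germ of h \<mu>s at qs can be obtained with k variables up to stable
   equivalence. Basis carries no order, so K is the set of those coordinate directions that are
   called t_1, ..., t_k, and R^k is the coordinate subspace span K: a function of t_1, ..., t_k
   is a function of coordinate_part K t. The family g is defined on all of R^k. *)
definition obtainable_with ::
  "nat \<Rightarrow> 'm::real_normed_vector \<Rightarrow> 'a::euclidean_space \<Rightarrow> ('m \<Rightarrow> 'a \<Rightarrow> real) \<Rightarrow> bool" where
  "obtainable_with k \<mu>s qs h \<longleftrightarrow>
     (\<exists>K N (T :: 'a set) \<theta> g Q c.
        K \<subseteq> Basis \<and> card K = k \<and>
        open N \<and> \<mu>s \<in> N \<and> open T \<and> 0 \<in> T \<and>
        smooth_family_on N T \<theta> \<and> (\<forall>\<mu>\<in>N. diffeomorphism_onto_open_image T (\<theta> \<mu>)) \<and>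
        \<theta> \<mu>s 0 = qs \<and>
        smooth_family_on N UNIV g \<and>
        nondegenerate_quadratic_form_on (span (Basis - K)) Q \<and>
        smooth_on N c \<and>
        (\<forall>\<mu>\<in>N. \<forall>t\<in>T.
           h \<mu> (\<theta> \<mu> t) = g \<mu> (coordinate_part K t) + Q (coordinate_part (Basis - K) t) + c \<mu>))"

end

theory Submission
  imports Defs
begin

text \<open>A vector in the kernel of the Hessian of \<open>h\<^sub>\<mu>\<close> at the critical point is tangent to both
  graphs \<open>df\<^sub>\<mu>\<close> and \<open>dg\<close>, hence corresponds to a common tangent vector of \<open>\<Gamma>\<^sub>\<mu>\<close> and the
  Dirichlet condition. Its \<open>x\<close>- and \<open>X\<close>-components vanish and its \<open>Y\<close>-component is determined by
  its \<open>y\<close>-component, so the kernel has dimension at most \<open>n\<close>. By the parametric splitting lemma,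
  an unfolding of a germ whose Hessian has corank \<open>k\<close> can be obtained with \<open>k\<close> variables; this is
  shown by splitting off one square at a time until the Hessian of the residual family vanishes.\<close>

section \<open>Calculus of smooth maps\<close>

text \<open>The parameter is not treated separately: it is a further coordinate of one function on a
  product space, and every coordinate change acts on the second component only. A splitting theorem
  without parameters, applied in a direction \<open>(0, e)\<close>, therefore already gives the
  parametric one.

  Taking one direction at a time replaces the diagonalisation of a Hessian by one-dimensional facts:
  Taylor's formula on a line and the smoothness of a square root. Once no remaining direction has a
  nonzero diagonal second derivative, polarisation makes the residual Hessian vanish on all
  remaining directions. The derivative of the coordinate change then carries these directions
  injectively into the kernel of the original Hessian; this works because at a critical point a
  Hessian transforms as a bilinear form.

  Tangent vectors of the two Lagrangian submanifolds are obtained by differentiating their defining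
  equations along the graphs of \<open>df\<close> and \<open>dg\<close>, pulled back by the inverse
  of the symplectomorphism.\<close>

lemma differentiable_order_on_cong:
  assumes "open S" "\<And>x. x \<in> S \<Longrightarrow> f x = g x" "differentiable_order_on n S f"
  shows "differentiable_order_on n S g"
  using assms(2,3)
proof (induction n arbitrary: f g)
  case 0
  then show ?case using continuous_on_cong by force
next
  case (Suc n)
  have der: "(g has_derivative frechet_derivative f (at x)) (at x)" if "x \<in> S" for x
    using has_derivative_transform_within_open[OF _ assms(1) that Suc.prems(1)] Suc.prems(2) that
    by (auto simp: frechet_derivative_works)
  have eq: "frechet_derivative f (at x) = frechet_derivative g (at x)" if "x \<in> S" for x
    using frechet_derivative_at[OF der[OF that]] .
  show ?case
    using Suc.IH[of "\<lambda>x. frechet_derivative f (at x) v" "\<lambda>x. frechet_derivative g (at x) v" for v]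
      Suc.prems(2) der eq
    by (auto simp: differentiable_def)
qed

text \<open>The recursive definition speaks of \<open>frechet_derivative\<close>; this rule lets the
  closure lemmas supply an explicit derivative formula instead.\<close>

lemma differentiable_order_on_SucI:
  assumes "open S" "\<And>x. x \<in> S \<Longrightarrow> (f has_derivative f' x) (at x)"
    and "\<And>v. differentiable_order_on n S (\<lambda>x. f' x v)"
  shows "differentiable_order_on (Suc n) S f"
proof -
  have "differentiable_order_on n S (\<lambda>x. frechet_derivative f (at x) v)" for v
    by (rule differentiable_order_on_cong[OF assms(1) _ assms(3)[of v]])
      (simp add: frechet_derivative_at[OF assms(2)])
  then show ?thesis using assms(2) by (auto simp: differentiable_def)
qed

lemma differentiable_order_on_Suc_has_derivative:
  assumes "differentiable_order_on (Suc n) S f" "x \<in> S"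
  shows "(f has_derivative frechet_derivative f (at x)) (at x)"
  using assms by (simp add: frechet_derivative_works)

lemma differentiable_order_on_SucD:
  "differentiable_order_on (Suc n) S f \<Longrightarrow> differentiable_order_on n S f"
proof (induction n arbitrary: f)
  case 0
  then show ?case
    by (auto intro!: continuous_at_imp_continuous_on differentiable_imp_continuous_within)
qed auto

lemma differentiable_order_on_continuous_on:
  "differentiable_order_on n S f \<Longrightarrow> continuous_on S f"
proof (induction n)
  case (Suc n)
  then show ?case using differentiable_order_on_SucD by blast
qed simp

lemma differentiable_order_on_subset:
  "differentiable_order_on n S f \<Longrightarrow> T \<subseteq> S \<Longrightarrow> differentiable_order_on n T f"
  by (induction n arbitrary: f) (auto intro: continuous_on_subset)

lemma differentiable_order_on_const: "differentiable_order_on n S (\<lambda>x. c)"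
  by (induction n arbitrary: c) (auto simp: frechet_derivative_const)

lemma differentiable_order_on_bounded_linear:
  assumes "bounded_linear f" "open S"
  shows "differentiable_order_on n S f"
proof (cases n)
  case 0
  then show ?thesis using assms(1) by (simp add: linear_continuous_on)
next
  case (Suc m)
  show ?thesis unfolding Suc
    by (rule differentiable_order_on_SucI[where f' = "\<lambda>x. f"])
      (use assms in \<open>auto intro: bounded_linear_imp_has_derivative differentiable_order_on_const\<close>)
qed

lemma differentiable_order_on_add:
  assumes "open S" "differentiable_order_on n S f" "differentiable_order_on n S g"
  shows "differentiable_order_on n S (\<lambda>x. f x + g x)"
  using assms(2,3)
proof (induction n arbitrary: f g)
  case 0
  then show ?case by (auto intro: continuous_on_add)
next
  case (Suc n)
  show ?case
    by (rule differentiable_order_on_SucI[OF assms(1) has_derivative_add])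
      (use Suc in \<open>auto intro: differentiable_order_on_Suc_has_derivative\<close>)
qed

lemma differentiable_order_on_sum:
  assumes "open S" "finite I" "\<And>i. i \<in> I \<Longrightarrow> differentiable_order_on n S (f i)"
  shows "differentiable_order_on n S (\<lambda>x. \<Sum>i\<in>I. f i x)"
  using assms(2,3)
  by (induction I) (auto intro: differentiable_order_on_const differentiable_order_on_add[OF assms(1)])

lemma (in bounded_bilinear) differentiable_order_on_prod:
  assumes "open S" "differentiable_order_on n S f" "differentiable_order_on n S g"
  shows "differentiable_order_on n S (\<lambda>x. prod (f x) (g x))"
  using assms(2,3)
proof (induction n arbitrary: f g)
  case 0
  then show ?case by (auto intro: continuous_on)
next
  case (Suc n)
  have fg: "differentiable_order_on n S f" "differentiable_order_on n S g"
    using Suc.prems differentiable_order_on_SucD by blast+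
  show ?case
  proof (rule differentiable_order_on_SucI[OF assms(1) FDERIV])
    show "differentiable_order_on n S (\<lambda>x. prod (f x) (frechet_derivative g (at x) v) +
        prod (frechet_derivative f (at x) v) (g x))" for v
      using Suc.prems by (intro differentiable_order_on_add assms(1) Suc.IH fg) auto
  qed (use Suc.prems in \<open>auto intro: differentiable_order_on_Suc_has_derivative\<close>)
qed

lemma differentiable_order_on_linear_compose:
  assumes "open S" "bounded_linear L" "differentiable_order_on n S f"
  shows "differentiable_order_on n S (\<lambda>x. L (f x))"
  using assms(3)
proof (induction n arbitrary: f)
  case 0
  then show ?case by (auto intro: bounded_linear.continuous_on assms)
next
  case (Suc n)
  show ?case
    by (rule differentiable_order_on_SucI[OF assms(1) bounded_linear.has_derivative[OF assms(2)]])
      (use Suc in \<open>auto intro: differentiable_order_on_Suc_has_derivative\<close>)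
qed

lemma linear_euclidean_representation:
  fixes x :: "'a::euclidean_space"
  assumes "linear L"
  shows "L x = (\<Sum>b\<in>Basis. (x \<bullet> b) *\<^sub>R L b)"
proof -
  have "L x = L (\<Sum>b\<in>Basis. (x \<bullet> b) *\<^sub>R b)" by (simp add: euclidean_representation)
  then show ?thesis using assms by (simp add: linear_sum linear_scale)
qed

text \<open>In the chain rule both the base point and the direction of the derivative of
  \<open>g\<close> vary with \<open>x\<close>. Expanding the direction in \<open>Basis\<close>
  leaves scalar functions times \<open>g'\<close> in fixed directions, and these are covered by the
  product rule and the induction hypothesis.\<close>

lemma differentiable_order_on_compose:
  fixes f :: "'a::real_normed_vector \<Rightarrow> 'b::euclidean_space"
  assumes "open S" "open T" "f ` S \<subseteq> T"
    and "differentiable_order_on n S f" "differentiable_order_on n T g"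
  shows "differentiable_order_on n S (\<lambda>x. g (f x))"
  using assms(4,5)
proof (induction n arbitrary: g)
  case 0
  then show ?case using continuous_on_compose2[OF _ _ assms(3)] by auto
next
  case (Suc n)
  let ?f' = "\<lambda>x. frechet_derivative f (at x)" and ?g' = "\<lambda>x. frechet_derivative g (at x)"
  show ?case
  proof (rule differentiable_order_on_SucI[OF assms(1)])
    fix x assume x: "x \<in> S"
    have g': "(g has_derivative ?g' (f x)) (at (f x))"
      using Suc.prems(2) x assms(3) by (intro differentiable_order_on_Suc_has_derivative) auto
    have "((\<lambda>x. g (f x)) has_derivative (\<lambda>v. ?g' (f x) (?f' x v))) (at x)"
      by (rule has_derivative_compose[OF differentiable_order_on_Suc_has_derivative[OF Suc.prems(1) x] g'])
    then show "((\<lambda>x. g (f x)) has_derivative (\<lambda>v. \<Sum>b\<in>Basis. (?f' x v \<bullet> b) *\<^sub>R ?g' (f x) b)) (at x)"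
      by (subst (asm) linear_euclidean_representation[OF has_derivative_linear[OF g']])
  next
    fix v
    have "differentiable_order_on n S (\<lambda>x. ?f' x v \<bullet> b)" for b
      using Suc.prems by (intro differentiable_order_on_linear_compose[OF assms(1) bounded_linear_inner_left]) auto
    moreover have "differentiable_order_on n S (\<lambda>x. ?g' (f x) b)" for b
      using Suc.prems differentiable_order_on_SucD[OF Suc.prems(1)] by (intro Suc.IH) auto
    ultimately show "differentiable_order_on n S (\<lambda>x. \<Sum>b\<in>Basis. (?f' x v \<bullet> b) *\<^sub>R ?g' (f x) b)"
      by (intro differentiable_order_on_sum assms(1)
          bounded_bilinear.differentiable_order_on_prod[OF bounded_bilinear_scaleR]) auto
  qed
qed

text \<open>The derivative is a polynomial in \<open>inverse x\<close> itself, so the induction on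
  the order closes.\<close>

lemma differentiable_order_on_inverse:
  "differentiable_order_on n (- {0}) (inverse :: real \<Rightarrow> real)"
proof (induction n)
  case 0
  then show ?case by (auto intro!: continuous_intros)
next
  case (Suc n)
  show ?case
  proof (rule differentiable_order_on_SucI)
    show "(inverse has_derivative (\<lambda>v. - (inverse x * v * inverse x))) (at x)" if "x \<in> - {0}" for x :: real
      using that by (auto intro: has_derivative_inverse')
    have "differentiable_order_on n (-{0}) (\<lambda>x::real. (- v) * (inverse x * inverse x))" for v
      by (intro bounded_bilinear.differentiable_order_on_prod[OF bounded_bilinear_mult] Suc
          differentiable_order_on_const) auto
    then show "differentiable_order_on n (-{0}) (\<lambda>x::real. - (inverse x * v * inverse x))" for v
      by (simp add: algebra_simps)
  qed auto
qed

lemma differentiable_order_on_sqrt: "differentiable_order_on n {0<..} sqrt"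
proof (induction n)
  case 0
  then show ?case by (auto intro!: continuous_intros)
next
  case (Suc n)
  show ?case
  proof (rule differentiable_order_on_SucI)
    show "(sqrt has_derivative (\<lambda>v. (inverse (sqrt x) / 2) * v)) (at x)" if "x \<in> {0<..}" for x
      using that by (intro DERIV_real_sqrt[unfolded has_field_derivative_def]) simp
    have "differentiable_order_on n {0<..} (\<lambda>x. inverse (sqrt x))"
      by (rule differentiable_order_on_compose[OF _ _ _ Suc differentiable_order_on_inverse]) auto
    then have "differentiable_order_on n {0<..} (\<lambda>x. (v / 2) * inverse (sqrt x))" for v
      by (intro bounded_bilinear.differentiable_order_on_prod[OF bounded_bilinear_mult]
          differentiable_order_on_const) auto
    then show "differentiable_order_on n {0<..} (\<lambda>x. (inverse (sqrt x) / 2) * v)" for v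
      by (simp add: algebra_simps)
  qed auto
qed

section \<open>Closure properties of smooth maps\<close>

lemma smooth_on_open: "smooth_on S f \<Longrightarrow> open S"
  by (simp add: smooth_on_def)

lemma smooth_on_subset: "smooth_on S f \<Longrightarrow> open T \<Longrightarrow> T \<subseteq> S \<Longrightarrow> smooth_on T f"
  by (auto simp: smooth_on_def intro: differentiable_order_on_subset)

lemma smooth_on_cong: "smooth_on S f \<Longrightarrow> (\<And>x. x \<in> S \<Longrightarrow> f x = g x) \<Longrightarrow> smooth_on S g"
  by (auto simp: smooth_on_def intro: differentiable_order_on_cong)

lemma smooth_on_continuous_on: "smooth_on S f \<Longrightarrow> continuous_on S f"
  by (metis differentiable_order_on.simps(1) smooth_on_def)

lemma smooth_on_has_derivative:
  "smooth_on S f \<Longrightarrow> x \<in> S \<Longrightarrow> (f has_derivative frechet_derivative f (at x)) (at x)"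
  by (meson differentiable_order_on_Suc_has_derivative smooth_on_def)

lemma smooth_on_linear_frechet_derivative:
  "smooth_on S f \<Longrightarrow> x \<in> S \<Longrightarrow> linear (frechet_derivative f (at x))"
  using smooth_on_has_derivative has_derivative_linear by blast

lemma smooth_on_frechet_derivative:
  "smooth_on S f \<Longrightarrow> smooth_on S (\<lambda>x. frechet_derivative f (at x) v)"
  unfolding smooth_on_def by (metis differentiable_order_on.simps(2))

lemma smooth_on_const: "open S \<Longrightarrow> smooth_on S (\<lambda>x. c)"
  by (simp add: smooth_on_def differentiable_order_on_const)

lemma smooth_on_bounded_linear: "bounded_linear f \<Longrightarrow> open S \<Longrightarrow> smooth_on S f"
  by (simp add: smooth_on_def differentiable_order_on_bounded_linear)

lemma smooth_on_add: "smooth_on S f \<Longrightarrow> smooth_on S g \<Longrightarrow> smooth_on S (\<lambda>x. f x + g x)"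
  by (simp add: smooth_on_def differentiable_order_on_add)

lemma smooth_on_linear_compose:
  "bounded_linear L \<Longrightarrow> smooth_on S f \<Longrightarrow> smooth_on S (\<lambda>x. L (f x))"
  by (simp add: smooth_on_def differentiable_order_on_linear_compose)

lemma smooth_on_diff: "smooth_on S f \<Longrightarrow> smooth_on S g \<Longrightarrow> smooth_on S (\<lambda>x. f x - g x)"
  using smooth_on_add[OF _ smooth_on_linear_compose[OF bounded_linear_minus[OF bounded_linear_ident]], of S f g]
  by simp

lemma smooth_on_Pair:
  assumes "smooth_on S f" "smooth_on S g"
  shows "smooth_on S (\<lambda>x. (f x, g x))"
proof -
  have "bounded_linear (\<lambda>a::'b. (a, 0::'c))" "bounded_linear (\<lambda>b::'c. (0::'b, b))"
    by (auto intro: bounded_linear_Pair bounded_linear_ident bounded_linear_zero)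
  from smooth_on_add[OF smooth_on_linear_compose[OF this(1) assms(1)]
      smooth_on_linear_compose[OF this(2) assms(2)]]
  show ?thesis by simp
qed

lemma smooth_on_scaleR: "smooth_on S f \<Longrightarrow> smooth_on S g \<Longrightarrow> smooth_on S (\<lambda>x. f x *\<^sub>R g x)"
  by (simp add: smooth_on_def bounded_bilinear.differentiable_order_on_prod[OF bounded_bilinear_scaleR])

lemma smooth_on_mult:
  fixes f g :: "'a::real_normed_vector \<Rightarrow> real"
  shows "smooth_on S f \<Longrightarrow> smooth_on S g \<Longrightarrow> smooth_on S (\<lambda>x. f x * g x)"
  using smooth_on_scaleR[of S f g] by simp

lemma smooth_on_inner: "smooth_on S f \<Longrightarrow> smooth_on S g \<Longrightarrow> smooth_on S (\<lambda>x. f x \<bullet> g x)"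
  by (simp add: smooth_on_def bounded_bilinear.differentiable_order_on_prod[OF bounded_bilinear_inner])

lemma smooth_on_compose:
  fixes f :: "'a::real_normed_vector \<Rightarrow> 'b::euclidean_space"
  assumes "smooth_on T g" "smooth_on S f" "\<And>x. x \<in> S \<Longrightarrow> f x \<in> T"
  shows "smooth_on S (\<lambda>x. g (f x))"
proof -
  have "open S" "open T" "f ` S \<subseteq> T" using assms by (auto simp: smooth_on_def)
  then show ?thesis
    using differentiable_order_on_compose[of S T f _ g] assms(1,2) by (simp add: smooth_on_def)
qed

lemma smooth_on_inverse:
  fixes f :: "'a::real_normed_vector \<Rightarrow> real"
  assumes "smooth_on S f" "\<And>x. x \<in> S \<Longrightarrow> f x \<noteq> 0"
  shows "smooth_on S (\<lambda>x. inverse (f x))"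
proof (rule smooth_on_compose[OF _ assms(1)])
  show "smooth_on (-{0}) (inverse :: real \<Rightarrow> real)"
    by (simp add: smooth_on_def differentiable_order_on_inverse open_Compl)
qed (use assms in auto)

lemma smooth_on_sqrt:
  assumes "smooth_on S f" "\<And>x. x \<in> S \<Longrightarrow> f x > 0"
  shows "smooth_on S (\<lambda>x. sqrt (f x))"
proof (rule smooth_on_compose[OF _ assms(1)])
  show "smooth_on {0<..} sqrt"
    by (simp add: smooth_on_def differentiable_order_on_sqrt)
qed (use assms in auto)

text \<open>Domains that are shrunk so that a composite is defined have this form.\<close>

lemma open_Collect_mem_continuous_on:
  assumes "continuous_on S f" "open S" "open T"
  shows "open {x \<in> S. f x \<in> T}"
  using continuous_open_preimage[OF assms] by (simp add: vimage_def Int_def)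

section \<open>The smooth inverse function theorem\<close>

text \<open>Since \<open>n\<close> vanishes at \<open>x\<close>, the product rule needs only
  continuity of \<open>p\<close>: the error \<open>(p y - p x) *\<^sub>R n y\<close> is a null
  factor times a term of order \<open>norm (y - x)\<close>. It serves wherever a coefficient is not
  yet known to be differentiable, or its derivative would be multiplied by zero.\<close>

lemma has_derivative_scaleR_vanishing:
  fixes n :: "'a::real_normed_vector \<Rightarrow> 'b::real_normed_vector"
  assumes p: "isCont p x" and n: "(n has_derivative n') (at x)" and "n x = 0"
  shows "((\<lambda>y. p y *\<^sub>R n y) has_derivative (\<lambda>u. p x *\<^sub>R n' u)) (at x)"
proof -
  obtain K where K: "\<And>u. norm (n' u) \<le> norm u * K"
    using has_derivative_bounded_linear[OF n] bounded_linear.bounded by blast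
  let ?r = "\<lambda>y. norm (n y - n' (y - x)) / norm (y - x)"
  have r: "(?r \<longlongrightarrow> 0) (at x)"
    using n \<open>n x = 0\<close> by (simp add: has_derivative_iff_norm)
  have bound: "norm (n y) / norm (y - x) \<le> ?r y + K" if "y \<noteq> x" for y
    using norm_triangle_sub[of "n y" "n' (y - x)"] K[of "y - x"] that
    by (simp add: divide_simps algebra_simps)
  have "((\<lambda>y. \<bar>p y - p x\<bar> * (?r y + K)) \<longlongrightarrow> \<bar>p x - p x\<bar> * (0 + K)) (at x)"
    using p by (intro tendsto_intros r) (auto simp: isCont_def)
  then have "((\<lambda>y. \<bar>p y - p x\<bar> * (?r y + K)) \<longlongrightarrow> 0) (at x)"
    by simp
  then have "((\<lambda>y. norm ((p y - p x) *\<^sub>R n y) / norm (y - x)) \<longlongrightarrow> 0) (at x)"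
  proof (rule Lim_null_comparison[rotated])
    show "\<forall>\<^sub>F y in at x. norm (norm ((p y - p x) *\<^sub>R n y) / norm (y - x)) \<le> \<bar>p y - p x\<bar> * (?r y + K)"
      using bound by (auto simp: eventually_at_filter simp flip: times_divide_eq_right
          intro!: always_eventually mult_left_mono)
  qed
  then have "((\<lambda>y. (p y - p x) *\<^sub>R n y) has_derivative (\<lambda>u. 0)) (at x)"
    using \<open>n x = 0\<close> by (simp add: has_derivative_iff_norm)
  from has_derivative_add[OF this has_derivative_scaleR_right[OF n, of "p x"]]
  show ?thesis by (simp add: algebra_simps)
qed

text \<open>The resolvent identity \<open>G x w = G0 w - G0 ((M x - M x0) (G x w))\<close> with
  \<open>z x = G x w\<close>. The difference is expanded in \<open>Basis\<close> so that each
  summand is a scalar times a vector vanishing at \<open>x0\<close>.\<close>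

lemma inverse_family_diff:
  assumes "linear (G0 :: 'c::real_vector \<Rightarrow> 'b::euclidean_space)" "linear (M x)" "linear (M x0)"
    and "M x (z x) = w" "\<And>v. G0 (M x0 v) = (v::'b)"
  shows "z x = G0 w - G0 (\<Sum>b\<in>Basis. (z x \<bullet> b) *\<^sub>R (M x b - M x0 b))"
proof -
  have "(\<Sum>b\<in>Basis. (z x \<bullet> b) *\<^sub>R (M x b - M x0 b)) = M x (z x) - M x0 (z x)"
    by (simp add: scaleR_diff_right sum_subtractf linear_euclidean_representation[OF assms(2), of "z x"]
        linear_euclidean_representation[OF assms(3), of "z x"])
  then show ?thesis using assms by (simp add: linear_diff)
qed

lemma continuous_on_inverse_family:
  fixes M :: "'a::real_normed_vector \<Rightarrow> 'b::euclidean_space \<Rightarrow> 'c::euclidean_space"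
  assumes "open S" "\<And>x. x \<in> S \<Longrightarrow> linear (M x)" "\<And>x. x \<in> S \<Longrightarrow> linear (G x)"
    and "\<And>x v. x \<in> S \<Longrightarrow> G x (M x v) = v" "\<And>x w. x \<in> S \<Longrightarrow> M x (G x w) = w"
    and "\<And>v. continuous_on S (\<lambda>x. M x v)"
  shows "continuous_on S (\<lambda>x. G x w)"
proof (rule continuous_at_imp_continuous_on, rule ballI)
  fix x0 assume x0: "x0 \<in> S"
  obtain C where C: "C > 0" "\<And>y. norm (G x0 y) \<le> C * norm y"
    using linear_bounded_pos[OF assms(3)[OF x0]] by blast
  define m where "m x = (\<Sum>b\<in>Basis. norm (M x b - M x0 b))" for x
  have "((\<lambda>x. \<Sum>b\<in>Basis. norm (M x b - M x0 b)) \<longlongrightarrow> (\<Sum>b\<in>Basis. norm (M x0 b - M x0 b))) (at x0)"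
    using assms(1,6) x0 by (intro tendsto_intros) (auto simp: continuous_on_eq_continuous_at isCont_def)
  then have m: "(m \<longlongrightarrow> 0) (at x0)" by (simp add: m_def[abs_def])
  have est: "norm (G x w - G x0 w) \<le> C * (norm (G x w) * m x)" if "x \<in> S" for x
  proof -
    have "G x w - G x0 w = - G x0 (\<Sum>b\<in>Basis. (G x w \<bullet> b) *\<^sub>R (M x b - M x0 b))"
      by (subst inverse_family_diff[of "G x0" M x x0 "\<lambda>x. G x w" w]) (use assms x0 that in auto)
    then have "norm (G x w - G x0 w) \<le> C * norm (\<Sum>b\<in>Basis. (G x w \<bullet> b) *\<^sub>R (M x b - M x0 b))"
      using C(2) by simp
    also have "norm (\<Sum>b\<in>Basis. (G x w \<bullet> b) *\<^sub>R (M x b - M x0 b)) \<le> norm (G x w) * m x"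
      unfolding m_def sum_distrib_left
      by (rule sum_norm_le) (simp add: mult_right_mono Basis_le_norm)
    finally show ?thesis using C(1) by simp
  qed
  \<comment> \<open>Below this bound the resolvent estimate absorbs half of
    \<open>norm (G x w)\<close>, which bounds \<open>G x w\<close> by twice
    \<open>norm (G x0 w)\<close>; continuity of \<open>G\<close> is not assumed.\<close>
  have "\<forall>\<^sub>F x in at x0. m x < 1 / (2 * C)"
    using m C(1) by (intro order_tendstoD(2)[OF m]) auto
  moreover have "\<forall>\<^sub>F x in at x0. x \<in> S"
    using assms(1) x0 by (simp add: eventually_at_in_open')
  ultimately have "\<forall>\<^sub>F x in at x0. norm (G x w - G x0 w) \<le> m x * (2 * C * norm (G x0 w))"
  proof eventually_elim
    case (elim x)
    have m0: "0 \<le> m x" by (simp add: m_def sum_nonneg)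
    have "C * (norm (G x w) * m x) \<le> C * (norm (G x w) * (1 / (2 * C)))"
      using elim C(1) by (intro mult_left_mono) auto
    then have "norm (G x w - G x0 w) \<le> norm (G x w) / 2"
      using est[OF elim(2)] C(1) by simp
    then have "norm (G x w) \<le> 2 * norm (G x0 w)"
      using norm_triangle_sub[of "G x w" "G x0 w"] by simp
    then have "C * (norm (G x w) * m x) \<le> C * (2 * norm (G x0 w) * m x)"
      using m0 C(1) by (intro mult_left_mono mult_right_mono) auto
    then show ?case using est[OF elim(2)] by (simp add: algebra_simps)
  qed
  moreover have "((\<lambda>x. m x * (2 * C * norm (G x0 w))) \<longlongrightarrow> 0) (at x0)"
    using tendsto_mult_right[OF m] by simp
  ultimately have "((\<lambda>x. G x w - G x0 w) \<longlongrightarrow> 0) (at x0)"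
    by (rule Lim_null_comparison)
  then show "isCont (\<lambda>x. G x w) x0"
    by (simp add: isCont_def LIM_zero_iff)
qed

text \<open>The familiar formula \<open>- G M' G\<close>. It follows by differentiating the
  resolvent identity, in which \<open>G x w\<close> occurs only as a coefficient of vanishing
  factors, so that continuity of the inverse suffices.\<close>

lemma has_derivative_inverse_family:
  fixes M :: "'a::real_normed_vector \<Rightarrow> 'b::euclidean_space \<Rightarrow> 'c::euclidean_space"
  assumes "open S" "x0 \<in> S" "\<And>x. x \<in> S \<Longrightarrow> linear (M x)" "\<And>x. x \<in> S \<Longrightarrow> linear (G x)"
    and "\<And>x v. x \<in> S \<Longrightarrow> G x (M x v) = v" "\<And>x w. x \<in> S \<Longrightarrow> M x (G x w) = w"
    and cont: "isCont (\<lambda>x. G x w) x0"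
    and M': "\<And>v. ((\<lambda>x. M x v) has_derivative M' v) (at x0)"
  shows "((\<lambda>x. G x w) has_derivative
    (\<lambda>u. - G x0 (\<Sum>b\<in>Basis. (G x0 w \<bullet> b) *\<^sub>R M' b u))) (at x0)"
proof -
  have "((\<lambda>x. (G x w \<bullet> b) *\<^sub>R (M x b - M x0 b)) has_derivative (\<lambda>u. (G x0 w \<bullet> b) *\<^sub>R M' b u)) (at x0)" for b
    using has_derivative_diff[OF M' has_derivative_const] cont
    by (intro has_derivative_scaleR_vanishing) (auto intro: continuous_intros)
  then have "((\<lambda>x. \<Sum>b\<in>Basis. (G x w \<bullet> b) *\<^sub>R (M x b - M x0 b)) has_derivative
      (\<lambda>u. \<Sum>b\<in>Basis. (G x0 w \<bullet> b) *\<^sub>R M' b u)) (at x0)"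
    by (rule has_derivative_sum)
  moreover have "bounded_linear (G x0)"
    using assms(2,4) by (simp add: linear_conv_bounded_linear)
  ultimately have "((\<lambda>x. G x0 (\<Sum>b\<in>Basis. (G x w \<bullet> b) *\<^sub>R (M x b - M x0 b))) has_derivative
      (\<lambda>u. G x0 (\<Sum>b\<in>Basis. (G x0 w \<bullet> b) *\<^sub>R M' b u))) (at x0)"
    by (rule bounded_linear.has_derivative[rotated])
  from has_derivative_diff[OF has_derivative_const[of "G x0 w"] this]
  have "((\<lambda>x. G x0 w - G x0 (\<Sum>b\<in>Basis. (G x w \<bullet> b) *\<^sub>R (M x b - M x0 b))) has_derivative
      (\<lambda>u. - G x0 (\<Sum>b\<in>Basis. (G x0 w \<bullet> b) *\<^sub>R M' b u))) (at x0)" by simp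
  then show ?thesis
  proof (rule has_derivative_transform_within_open[OF _ assms(1,2)])
    fix x assume "x \<in> S"
    then show "G x0 w - G x0 (\<Sum>b\<in>Basis. (G x w \<bullet> b) *\<^sub>R (M x b - M x0 b)) = G x w"
      using inverse_family_diff[of "G x0" M x x0 "\<lambda>x. G x w" w] assms(2-6) by simp
  qed
qed

text \<open>The derivative formula expresses the derivative of \<open>G\<close> through
  \<open>G\<close> and the derivative of \<open>M\<close>, so each order of differentiability of
  \<open>M\<close> passes on to \<open>G\<close>.\<close>

lemma differentiable_order_on_inverse_family:
  fixes M :: "'a::real_normed_vector \<Rightarrow> 'b::euclidean_space \<Rightarrow> 'c::euclidean_space"
  assumes "open S" "\<And>x. x \<in> S \<Longrightarrow> linear (M x)" "\<And>x. x \<in> S \<Longrightarrow> linear (G x)"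
    and "\<And>x v. x \<in> S \<Longrightarrow> G x (M x v) = v" "\<And>x w. x \<in> S \<Longrightarrow> M x (G x w) = w"
    and "\<And>v. differentiable_order_on n S (\<lambda>x. M x v)"
  shows "differentiable_order_on n S (\<lambda>x. G x w)"
  using assms(6)
proof (induction n arbitrary: w)
  case 0
  then show ?case using continuous_on_inverse_family[of S M G] assms(1-5) by simp
next
  case (Suc n)
  have G: "differentiable_order_on n S (\<lambda>x. G x w)" for w
    using Suc.IH Suc.prems differentiable_order_on_SucD by blast
  then have cont: "isCont (\<lambda>x. G x w) x" if "x \<in> S" for x
    using that differentiable_order_on_continuous_on[of n S] assms(1)
    by (auto simp: continuous_on_eq_continuous_at)
  let ?M' = "\<lambda>x v. frechet_derivative (\<lambda>x. M x v) (at x)"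
  let ?E = "\<lambda>x u. \<Sum>b\<in>Basis. (G x w \<bullet> b) *\<^sub>R ?M' x b u"
  show ?case
  proof (rule differentiable_order_on_SucI[OF assms(1)])
    fix x assume x: "x \<in> S"
    have "((\<lambda>x. G x w) has_derivative (\<lambda>u. - G x (?E x u))) (at x)"
      using differentiable_order_on_Suc_has_derivative[OF Suc.prems x]
      by (intro has_derivative_inverse_family[of S x M G]) (use assms x cont in auto)
    then show "((\<lambda>x. G x w) has_derivative (\<lambda>u. - (\<Sum>c\<in>Basis. (?E x u \<bullet> c) *\<^sub>R G x c))) (at x)"
      by (subst (asm) linear_euclidean_representation[OF assms(3)[OF x]])
  next
    fix u
    have "differentiable_order_on n S (\<lambda>x. ?E x u)"
      using Suc.prems by (intro differentiable_order_on_sum assms(1)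
          bounded_bilinear.differentiable_order_on_prod[OF bounded_bilinear_scaleR]
          differentiable_order_on_linear_compose[OF assms(1) bounded_linear_inner_left] G) auto
    then have "differentiable_order_on n S (\<lambda>x. ?E x u \<bullet> c)" for c
      by (rule differentiable_order_on_linear_compose[OF assms(1) bounded_linear_inner_left])
    then have "differentiable_order_on n S (\<lambda>x. \<Sum>c\<in>Basis. (?E x u \<bullet> c) *\<^sub>R G x c)"
      by (intro differentiable_order_on_sum assms(1)
          bounded_bilinear.differentiable_order_on_prod[OF bounded_bilinear_scaleR] G) auto
    then show "differentiable_order_on n S (\<lambda>x. - (\<Sum>c\<in>Basis. (?E x u \<bullet> c) *\<^sub>R G x c))"
      by (rule differentiable_order_on_linear_compose[OF assms(1) bounded_linear_minus[OF bounded_linear_ident]])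
  qed
qed

section \<open>Smooth local inverses\<close>

definition smooth_local_inverse ::
  "'a::real_normed_vector set \<Rightarrow> 'b::real_normed_vector set \<Rightarrow> ('a \<Rightarrow> 'b) \<Rightarrow> ('b \<Rightarrow> 'a) \<Rightarrow> bool" where
  "smooth_local_inverse U V f g \<longleftrightarrow> open U \<and> smooth_on V g \<and>
     (\<forall>x\<in>U. f x \<in> V \<and> g (f x) = x) \<and> (\<forall>y\<in>V. g y \<in> U \<and> f (g y) = y)"

text \<open>The inverse function theorem gives a differentiable local inverse \<open>g\<close> with
  derivative the inverse of \<open>f'\<close> at \<open>g y\<close>. Smoothness follows by
  bootstrapping: if \<open>g\<close> has order \<open>n\<close>, so has \<open>f'\<close> at
  \<open>g y\<close>, hence so has its inverse, which is the derivative of \<open>g\<close>.\<close>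

theorem smooth_inverse_function:
  fixes f :: "'a::euclidean_space \<Rightarrow> 'a"
  assumes f: "smooth_on S f" and x0: "x0 \<in> S"
    and inj: "\<And>v. frechet_derivative f (at x0) v = 0 \<Longrightarrow> v = 0"
  obtains U V g where "U \<subseteq> S" "x0 \<in> U" "smooth_local_inverse U V f g"
proof -
  let ?f' = "\<lambda>x. Blinfun (frechet_derivative f (at x))"
  have S: "open S" using f smooth_on_open by blast
  have f': "blinfun_apply (?f' x) = frechet_derivative f (at x)" if "x \<in> S" for x
    using smooth_on_linear_frechet_derivative[OF f that]
    by (simp add: bounded_linear_Blinfun_apply linear_conv_bounded_linear)
  have "linear (frechet_derivative f (at x0))"
    by (rule smooth_on_linear_frechet_derivative[OF f x0])
  moreover from this have "inj (frechet_derivative f (at x0))"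
    using inj linear_injective_0 by blast
  ultimately obtain h where h: "linear h" "\<And>v. h (frechet_derivative f (at x0) v) = v"
    using linear_injective_isomorphism by metis
  have hB: "blinfun_apply (Blinfun h) = h"
    using h(1) by (simp add: bounded_linear_Blinfun_apply linear_conv_bounded_linear)
  have "continuous_on S ?f'"
  proof (rule continuous_on_blinfun_componentwise)
    show "continuous_on S (\<lambda>x. blinfun_apply (?f' x) i)" for i
      using smooth_on_continuous_on[OF smooth_on_frechet_derivative[OF f, of i]]
      by (rule continuous_on_eq) (simp add: f')
  qed
  moreover have "Blinfun h o\<^sub>L ?f' x0 = id_blinfun"
    by (rule blinfun_eqI) (simp add: hB f'[OF x0] h(2))
  moreover have "(f has_derivative blinfun_apply (?f' x)) (at x)" if "x \<in> S" for x
    using smooth_on_has_derivative[OF f that] f'[OF that] by simp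
  ultimately obtain U V g g' where UV: "open U" "U \<subseteq> S" "x0 \<in> U" "open V" "homeomorphism U V f g"
    and g': "\<And>y. y \<in> V \<Longrightarrow> (g has_derivative g' y) (at y)"
      "\<And>y. y \<in> V \<Longrightarrow> g' y = inv (blinfun_apply (?f' (g y)))"
      "\<And>y. y \<in> V \<Longrightarrow> bij (blinfun_apply (?f' (g y)))"
    using inverse_function_theorem[OF S _ _ x0, of f ?f' "Blinfun h"] by metis
  have gV: "g y \<in> U" if "y \<in> V" for y
    using UV(5) that by (auto simp: homeomorphism_def)
  have gS: "g ` V \<subseteq> S" using gV UV(2) by blast
  let ?M = "\<lambda>y. frechet_derivative f (at (g y))"
  have linM: "linear (?M y)" if "y \<in> V" for y
    using smooth_on_linear_frechet_derivative[OF f] gS that by blast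
  have bijM: "bij (?M y)" and g'M: "g' y = inv (?M y)" if "y \<in> V" for y
    using g'(2,3)[OF that] f' gS that by auto
  have "differentiable_order_on n V g" for n
  proof (induction n)
    case 0
    then show ?case using UV(5) by (simp add: homeomorphism_def)
  next
    case (Suc n)
    show ?case
    proof (rule differentiable_order_on_SucI[OF UV(4) g'(1)])
      fix v
      have "differentiable_order_on n V (\<lambda>y. ?M y v)" for v
        by (rule differentiable_order_on_compose[OF UV(4) S gS Suc])
          (use smooth_on_frechet_derivative[OF f, of v] in \<open>simp add: smooth_on_def\<close>)
      then show "differentiable_order_on n V (\<lambda>y. g' y v)"
      proof (rule differentiable_order_on_inverse_family[OF UV(4) linM, rotated 4])
        show "linear (g' y)" if "y \<in> V" for y
          using g'(1)[OF that] has_derivative_linear by blast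
        show "g' y (?M y v) = v" "?M y (g' y v) = v" if "y \<in> V" for y v
          using bijM[OF that] unfolding g'M[OF that] by (simp_all add: bij_def surj_f_inv_f)
      qed
    qed
  qed
  then have "smooth_on V g" using UV(4) by (simp add: smooth_on_def)
  then show ?thesis
    using that[OF UV(2,3), of V g] UV(1,5) gV by (auto simp: homeomorphism_def smooth_local_inverse_def)
qed

section \<open>Second derivatives and integrals with parameters\<close>

lemma smooth_on_has_real_derivative_line:
  fixes f :: "'a::real_normed_vector \<Rightarrow> real"
  assumes "smooth_on S f" "x + a *\<^sub>R u \<in> S"
  shows "((\<lambda>a. f (x + a *\<^sub>R u)) has_real_derivative frechet_derivative f (at (x + a *\<^sub>R u)) u) (at a)"
proof -
  have "((\<lambda>a. x + a *\<^sub>R u) has_derivative (\<lambda>t. t *\<^sub>R u)) (at a)"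
    by (auto intro!: derivative_eq_intros)
  from has_derivative_compose[OF this smooth_on_has_derivative[OF assms]]
  show ?thesis
    unfolding has_field_derivative_def
    by (rule has_derivative_eq_rhs) (simp add: fun_eq_iff mult.commute
        linear_scale[OF smooth_on_linear_frechet_derivative[OF assms]])
qed

text \<open>Two applications of the mean value theorem, first in direction \<open>u\<close> to the
  difference of \<open>f\<close> on two parallel segments, then in direction \<open>v\<close> to the
  derivative along \<open>u\<close>.\<close>

lemma mixed_difference_mean_value:
  fixes f :: "'a::real_normed_vector \<Rightarrow> real"
  assumes f: "smooth_on S f" and "s > 0"
    and S: "\<And>a b. a \<in> {0..s} \<Longrightarrow> b \<in> {0..s} \<Longrightarrow> x + a *\<^sub>R u + b *\<^sub>R v \<in> S"
  obtains a b where "a \<in> {0..s}" "b \<in> {0..s}"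
    "f (x + s *\<^sub>R u + s *\<^sub>R v) - f (x + s *\<^sub>R u) - f (x + s *\<^sub>R v) + f x
      = s * (s * frechet_derivative (\<lambda>y. frechet_derivative f (at y) u) (at (x + a *\<^sub>R u + b *\<^sub>R v)) v)"
proof -
  let ?Du = "\<lambda>y. frechet_derivative f (at y) u"
  have "((\<lambda>a. f (x + s *\<^sub>R v + a *\<^sub>R u) - f (x + a *\<^sub>R u)) has_real_derivative
      ?Du (x + s *\<^sub>R v + a *\<^sub>R u) - ?Du (x + a *\<^sub>R u)) (at a)" if "0 \<le> a" "a \<le> s" for a
    using S[of a s] S[of a 0] that \<open>s > 0\<close>
    by (intro DERIV_diff smooth_on_has_real_derivative_line[OF f]) (auto simp: algebra_simps)
  from MVT2[OF \<open>s > 0\<close> this] obtain a where a: "0 < a" "a < s"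
    "f (x + s *\<^sub>R v + s *\<^sub>R u) - f (x + s *\<^sub>R u) - (f (x + s *\<^sub>R v) - f x)
      = s * (?Du (x + s *\<^sub>R v + a *\<^sub>R u) - ?Du (x + a *\<^sub>R u))"
    by auto
  have "((\<lambda>b. ?Du (x + a *\<^sub>R u + b *\<^sub>R v)) has_real_derivative
      frechet_derivative ?Du (at (x + a *\<^sub>R u + b *\<^sub>R v)) v) (at b)" if "0 \<le> b" "b \<le> s" for b
    using S[of a b] a that
    by (intro smooth_on_has_real_derivative_line[OF smooth_on_frechet_derivative[OF f]]) auto
  from MVT2[OF \<open>s > 0\<close> this] obtain b where "0 < b" "b < s"
    "?Du (x + a *\<^sub>R u + s *\<^sub>R v) - ?Du (x + a *\<^sub>R u)
      = s * frechet_derivative ?Du (at (x + a *\<^sub>R u + b *\<^sub>R v)) v"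
    by auto
  then show ?thesis using a by (intro that[of a b]) (auto simp: algebra_simps)
qed

text \<open>The second difference over a parallelogram is symmetric in \<open>u\<close> and
  \<open>v\<close>, so the two mixed derivatives agree at suitable points of arbitrarily small
  parallelograms; continuity carries this to \<open>x\<close>.\<close>

theorem smooth_on_second_derivative_commute:
  fixes f :: "'a::real_normed_vector \<Rightarrow> real"
  assumes f: "smooth_on S f" and x: "x \<in> S"
  shows "frechet_derivative (\<lambda>y. frechet_derivative f (at y) u) (at x) v
    = frechet_derivative (\<lambda>y. frechet_derivative f (at y) v) (at x) u"
    (is "?A u v x = ?A v u x")
proof (rule ccontr)
  assume neq: "?A u v x \<noteq> ?A v u x"
  define e where "e = dist (?A u v x) (?A v u x) / 2"
  have e: "e > 0" using neq by (simp add: e_def)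
  have S: "open S" using f smooth_on_open by blast
  have "continuous_on S (?A u v)" "continuous_on S (?A v u)"
    using f by (intro smooth_on_continuous_on smooth_on_frechet_derivative; simp)+
  then have "isCont (?A u v) x" "isCont (?A v u) x"
    using S x by (auto simp: continuous_on_eq_continuous_at)
  then obtain d1 d2 where d: "d1 > 0" "d2 > 0"
    "\<And>y. dist y x < d1 \<Longrightarrow> dist (?A u v y) (?A u v x) < e"
    "\<And>y. dist y x < d2 \<Longrightarrow> dist (?A v u y) (?A v u x) < e"
    unfolding continuous_at_eps_delta using e by metis
  obtain d3 where d3: "d3 > 0" "ball x d3 \<subseteq> S"
    using S x open_contains_ball by blast
  define d where "d = Min {d1, d2, d3}"
  have dle: "d > 0" "d \<le> d1" "d \<le> d2" "d \<le> d3" using d(1,2) d3(1) by (auto simp: d_def)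
  \<comment> \<open>Small enough to keep the whole parallelogram within distance \<open>d\<close> of
    \<open>x\<close>; the summand 1 keeps the denominator positive when \<open>u\<close> and
    \<open>v\<close> vanish.\<close>
  define s where "s = d / (2 * (norm u + norm v + 1))"
  have s: "s > 0"
    unfolding s_def using dle(1) by (intro divide_pos_pos mult_pos_pos add_nonneg_pos) auto
  have close: "dist (x + a *\<^sub>R u + b *\<^sub>R v) x < d" if "a \<in> {0..s}" "b \<in> {0..s}" for a b
  proof -
    have "dist (x + a *\<^sub>R u + b *\<^sub>R v) x \<le> norm (a *\<^sub>R u) + norm (b *\<^sub>R v)"
      using norm_triangle_ineq[of "a *\<^sub>R u" "b *\<^sub>R v"] by (simp add: dist_norm add.assoc)
    also have "\<dots> \<le> s * norm u + s * norm v"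
      using that by (auto intro!: add_mono mult_right_mono)
    also have "\<dots> < s * (2 * (norm u + norm v + 1))"
      using s by (simp add: distrib_left add_nonneg_pos)
    also have "\<dots> = d"
    proof -
      have "norm u + norm v + 1 > 0" by (intro add_nonneg_pos) auto
      then show ?thesis unfolding s_def by simp
    qed
    finally show ?thesis .
  qed
  have in_S: "x + a *\<^sub>R u + b *\<^sub>R v \<in> S" if "a \<in> {0..s}" "b \<in> {0..s}" for a b
    using close[OF that] dle(4) d3(2) by (auto simp: dist_commute)
  have in_S': "x + b *\<^sub>R v + a *\<^sub>R u \<in> S" if "b \<in> {0..s}" "a \<in> {0..s}" for a b
    using in_S[OF that(2,1)] by (simp add: algebra_simps)
  obtain a b where ab: "a \<in> {0..s}" "b \<in> {0..s}"
    "f (x + s *\<^sub>R u + s *\<^sub>R v) - f (x + s *\<^sub>R u) - f (x + s *\<^sub>R v) + f x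
      = s * (s * ?A u v (x + a *\<^sub>R u + b *\<^sub>R v))"
    using mixed_difference_mean_value[OF f s in_S] by metis
  obtain a' b' where ab': "a' \<in> {0..s}" "b' \<in> {0..s}"
    "f (x + s *\<^sub>R v + s *\<^sub>R u) - f (x + s *\<^sub>R v) - f (x + s *\<^sub>R u) + f x
      = s * (s * ?A v u (x + a' *\<^sub>R v + b' *\<^sub>R u))"
    using mixed_difference_mean_value[OF f s in_S'] by metis
  have "s * (s * ?A u v (x + a *\<^sub>R u + b *\<^sub>R v)) = s * (s * ?A v u (x + a' *\<^sub>R v + b' *\<^sub>R u))"
    unfolding ab(3)[symmetric] ab'(3)[symmetric] by (simp add: algebra_simps)
  then have "?A u v (x + a *\<^sub>R u + b *\<^sub>R v) = ?A v u (x + a' *\<^sub>R v + b' *\<^sub>R u)"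
    using s by simp
  moreover have "dist (?A u v (x + a *\<^sub>R u + b *\<^sub>R v)) (?A u v x) < e"
    using d(3) close[OF ab(1,2)] dle by auto
  moreover have "dist (?A v u (x + a' *\<^sub>R v + b' *\<^sub>R u)) (?A v u x) < e"
    using d(4) close[OF ab'(2,1)] dle by (auto simp: algebra_simps)
  ultimately have "dist (?A u v (x + a *\<^sub>R u + b *\<^sub>R v)) (?A u v x) < dist (?A u v x) (?A v u x) / 2"
    "dist (?A u v (x + a *\<^sub>R u + b *\<^sub>R v)) (?A v u x) < dist (?A u v x) (?A v u x) / 2"
    unfolding e_def by simp_all
  from dist_triangle_half_r[OF this] show False by simp
qed

text \<open>Differentiation under the integral sign, iterated. The open set \<open>V\<close> around
  the unit interval is there because differentiability on \<open>U \<times> V\<close> is two-sided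
  and meant for open sets.\<close>

lemma differentiable_order_on_integral:
  fixes f :: "'a::euclidean_space \<times> real \<Rightarrow> real"
  assumes "open U" "open V" "{0..1} \<subseteq> V" "differentiable_order_on n (U \<times> V) f"
  shows "differentiable_order_on n U (\<lambda>x. integral {0..1} (\<lambda>t. f (x, t)))"
  using assms(4)
proof (induction n arbitrary: f)
  case 0
  then have "continuous_on (U \<times> cbox 0 1) f"
    using assms(3) by (auto elim!: continuous_on_subset)
  then show ?case
    using integral_continuous_on_param[of U 0 "1::real" "\<lambda>x t. f (x, t)"] by simp
next
  case (Suc n)
  let ?f' = "\<lambda>z. frechet_derivative f (at z)"
  let ?fx = "\<lambda>x t. Blinfun (\<lambda>v. ?f' (x, t) (v, 0))"
  have f': "(f has_derivative ?f' (x, t)) (at (x, t))" if "x \<in> U" "t \<in> V" for x t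
    using differentiable_order_on_Suc_has_derivative[OF Suc.prems] that by simp
  have fx: "blinfun_apply (?fx x t) = (\<lambda>v. ?f' (x, t) (v, 0))" if "x \<in> U" "t \<in> V" for x t
    by (rule bounded_linear_Blinfun_apply[OF bounded_linear_compose[OF
          has_derivative_bounded_linear[OF f'[OF that]]
          bounded_linear_Pair[OF bounded_linear_ident bounded_linear_zero]]])
  have UV: "U \<times> cbox 0 1 \<subseteq> U \<times> V" using assms(3) by auto
  have cont: "continuous_on (U \<times> cbox 0 1) (\<lambda>(x, t). ?fx x t)"
  proof (rule continuous_on_blinfun_componentwise)
    fix i :: 'a
    have "continuous_on (U \<times> V) (\<lambda>z. ?f' z (i, 0))"
      by (rule differentiable_order_on_continuous_on[of n]) (use Suc.prems in simp)
    from continuous_on_subset[OF this UV]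
    show "continuous_on (U \<times> cbox 0 1) (\<lambda>z. blinfun_apply (case z of (x, t) \<Rightarrow> ?fx x t) i)"
      by (rule continuous_on_eq) (use fx assms(3) in auto)
  qed
  show ?case
  proof (rule differentiable_order_on_SucI[OF assms(1)])
    fix x assume x: "x \<in> U"
    \<comment> \<open>The Leibniz rule is applied on a ball because it asks for a convex
      domain.\<close>
    then obtain r where r: "r > 0" "ball x r \<subseteq> U"
      using assms(1) open_contains_ball by blast
    have "((\<lambda>x. integral (cbox 0 1) (\<lambda>t. f (x, t))) has_derivative
        integral (cbox 0 1) (?fx x)) (at x within ball x r)"
    proof (rule leibniz_rule)
      fix y t assume y: "y \<in> ball x r" and t: "t \<in> cbox 0 (1::real)"
      have "((\<lambda>y. (y, t)) has_derivative (\<lambda>v. (v, 0))) (at y)"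
        by (auto intro!: derivative_eq_intros)
      moreover have yt: "y \<in> U" "t \<in> V" using y t r assms(3) by auto
      ultimately have "((\<lambda>y. f (y, t)) has_derivative (\<lambda>v. ?f' (y, t) (v, 0))) (at y)"
        using has_derivative_compose[of "\<lambda>y. (y, t)" "\<lambda>v. (v, 0)" y UNIV f "?f' (y, t)"] f' by blast
      then show "((\<lambda>y. f (y, t)) has_derivative ?fx y t) (at y within ball x r)"
        using fx[OF yt] by (auto intro: has_derivative_at_withinI)
    next
      fix y assume y: "y \<in> ball x r"
      have "continuous_on (U \<times> V) f"
        using Suc.prems by (rule differentiable_order_on_continuous_on)
      then have "continuous_on (cbox 0 1) (\<lambda>t. f (y, t))"
        using y r assms(3) by (auto intro!: continuous_on_compose2[of "U \<times> V" f] continuous_intros)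
      then show "(\<lambda>t. f (y, t)) integrable_on cbox 0 1"
        by (rule integrable_continuous)
    next
      show "continuous_on (ball x r \<times> cbox 0 1) (\<lambda>(x, t). ?fx x t)"
        using cont by (rule continuous_on_subset) (use r in auto)
    qed (use r in auto)
    then have *: "((\<lambda>x. integral {0..1} (\<lambda>t. f (x, t))) has_derivative
        integral {0..1} (?fx x)) (at x)"
      using r by (simp add: at_within_open[of x "ball x r"])
    have "continuous_on (cbox 0 1) (\<lambda>t. case (x, t) of (x, t) \<Rightarrow> ?fx x t)"
      by (rule continuous_on_compose2[OF cont]) (use x in \<open>auto intro!: continuous_intros\<close>)
    then have int: "?fx x integrable_on {0..1}"
      using integrable_continuous by fastforce
    have "blinfun_apply (integral {0..1} (?fx x)) v = integral {0..1} (\<lambda>t. ?f' (x, t) (v, 0))" for v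
    proof -
      have "blinfun_apply (integral {0..1} (?fx x)) v = integral {0..1} (\<lambda>t. blinfun_apply (?fx x t) v)"
        using integral_linear[OF int blinfun.bounded_linear_left, of v] by (simp add: o_def)
      also have "\<dots> = integral {0..1} (\<lambda>t. ?f' (x, t) (v, 0))"
        by (rule integral_cong) (use fx[OF x] assms(3) in auto)
      finally show ?thesis .
    qed
    then have "blinfun_apply (integral {0..1} (?fx x)) = (\<lambda>v. integral {0..1} (\<lambda>t. ?f' (x, t) (v, 0)))"
      by blast
    with * show "((\<lambda>x. integral {0..1} (\<lambda>t. f (x, t))) has_derivative
        (\<lambda>v. integral {0..1} (\<lambda>t. ?f' (x, t) (v, 0)))) (at x)"
      by simp
  next
    fix v
    show "differentiable_order_on n U (\<lambda>x. integral {0..1} (\<lambda>t. ?f' (x, t) (v, 0)))"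
      using Suc.IH[of "\<lambda>z. ?f' z (v, 0)"] Suc.prems by simp
  qed
qed

lemma smooth_on_integral:
  fixes f :: "'a::euclidean_space \<times> real \<Rightarrow> real"
  assumes "smooth_on (U \<times> V) f" "open U" "open V" "{0..1} \<subseteq> V"
  shows "smooth_on U (\<lambda>x. integral {0..1} (\<lambda>t. f (x, t)))"
  using assms(1) differentiable_order_on_integral[OF assms(2-4)] assms(2) by (simp add: smooth_on_def)

text \<open>The auxiliary function \<open>?k\<close> is Taylor's formula before integration by
  parts: it equals \<open>h (c + s *\<^sub>R e)\<close> at 1 and, as \<open>F c = 0\<close>,
  \<open>h c\<close> at 0, and the first-order terms cancel in its derivative.\<close>

lemma taylor_critical_line:
  fixes h :: "'a::real_normed_vector \<Rightarrow> real" and e :: 'a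
  defines "F \<equiv> \<lambda>p. frechet_derivative h (at p) e"
  assumes h: "smooth_on D h" and "F c = 0"
    and seg: "\<And>t. t \<in> {0..1} \<Longrightarrow> c + (t * s) *\<^sub>R e \<in> D"
  shows "h (c + s *\<^sub>R e)
    = h c + s\<^sup>2 * integral {0..1} (\<lambda>t. (1 - t) * frechet_derivative F (at (c + (t * s) *\<^sub>R e)) e)"
proof -
  let ?k = "\<lambda>t. h (c + (t * s) *\<^sub>R e) + ((1 - t) * s) * F (c + (t * s) *\<^sub>R e)"
  let ?Fe = "\<lambda>p. frechet_derivative F (at p) e"
  have F: "smooth_on D F" unfolding F_def by (rule smooth_on_frechet_derivative[OF h])
  have "(?k has_real_derivative s\<^sup>2 * ((1 - t) * ?Fe (c + (t * s) *\<^sub>R e))) (at t)" if "t \<in> {0..1}" for t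
  proof -
    have t: "((\<lambda>t. t * s) has_real_derivative s) (at t)" by (auto intro!: derivative_eq_intros)
    note D = DERIV_chain2[OF smooth_on_has_real_derivative_line[OF _ seg[OF that]] t]
    have "((\<lambda>t. h (c + (t * s) *\<^sub>R e)) has_real_derivative F (c + (t * s) *\<^sub>R e) * s) (at t)"
      unfolding F_def by (rule D[OF h])
    moreover have "((\<lambda>t. F (c + (t * s) *\<^sub>R e)) has_real_derivative ?Fe (c + (t * s) *\<^sub>R e) * s) (at t)"
      by (rule D[OF F])
    ultimately show ?thesis
      by (auto intro!: derivative_eq_intros simp: power2_eq_square algebra_simps)
  qed
  then have "((\<lambda>t. s\<^sup>2 * ((1 - t) * ?Fe (c + (t * s) *\<^sub>R e))) has_integral (?k 1 - ?k 0)) {0..1}"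
    by (intro fundamental_theorem_of_calculus)
      (auto simp flip: has_real_derivative_iff_has_vector_derivative intro: has_field_derivative_at_within)
  from integral_unique[OF this] show ?thesis using \<open>F c = 0\<close> by simp
qed

section \<open>Splitting off one square\<close>

text \<open>The map \<open>\<Phi>\<close> replaces the coordinate \<open>l\<close> by
  \<open>Y\<close> and moves points only along \<open>e\<close>. Its local inverse therefore has the
  form \<open>q + r q *\<^sub>R e\<close>, and there \<open>Y\<close> becomes the coordinate
  \<open>l\<close>. The condition on \<open>1 + r'\<close> says that this inverse does not collapse
  the direction \<open>e\<close>.\<close>

lemma solve_coordinate:
  fixes e p0 :: "'a::euclidean_space" and Y :: "'a \<Rightarrow> real" and l :: "'a \<Rightarrow> real"
  assumes l: "linear l" "l e = 1" and Y: "smooth_on S Y" and p0: "p0 \<in> S"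
    and Ye: "frechet_derivative Y (at p0) e \<noteq> 0"
    and q0_def: "q0 = p0 - l p0 *\<^sub>R e + Y p0 *\<^sub>R e"
  obtains V r where "open V" "q0 \<in> V" "smooth_on V r" "q0 + r q0 *\<^sub>R e = p0"
    "1 + frechet_derivative r (at q0) e \<noteq> 0"
    "\<And>q. q \<in> V \<Longrightarrow> q + r q *\<^sub>R e \<in> S" "\<And>q. q \<in> V \<Longrightarrow> Y (q + r q *\<^sub>R e) = l q"
proof -
  have bl: "bounded_linear l" using l(1) by (simp add: linear_conv_bounded_linear)
  have S: "open S" using Y smooth_on_open by blast
  define \<Phi> where "\<Phi> p = p - l p *\<^sub>R e + Y p *\<^sub>R e" for p
  have l\<Phi>: "l (\<Phi> p) = Y p" for p
    using l by (simp add: \<Phi>_def linear_add linear_diff linear_scale)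
  have \<Phi>: "smooth_on S \<Phi>" unfolding \<Phi>_def[abs_def]
    by (intro smooth_on_add smooth_on_diff smooth_on_scaleR Y smooth_on_const S
        smooth_on_bounded_linear bl bounded_linear_ident)
  have "(\<Phi> has_derivative (\<lambda>v. v - l v *\<^sub>R e + frechet_derivative Y (at p0) v *\<^sub>R e)) (at p0)"
    unfolding \<Phi>_def[abs_def]
    by (intro derivative_intros bounded_linear_imp_has_derivative[OF bl] smooth_on_has_derivative[OF Y p0])
  from frechet_derivative_at[OF this, symmetric]
  have D\<Phi>: "frechet_derivative \<Phi> (at p0) v = v - l v *\<^sub>R e + frechet_derivative Y (at p0) v *\<^sub>R e" for v
    by simp
  have inj: "v = 0" if "frechet_derivative \<Phi> (at p0) v = 0" for v
  proof -
    have 0: "v - l v *\<^sub>R e + frechet_derivative Y (at p0) v *\<^sub>R e = 0" using that D\<Phi> by simp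
    \<comment> \<open>Applying \<open>l\<close> cancels the first two terms, since
      \<open>l e = 1\<close>, and isolates the derivative of \<open>Y\<close>.\<close>
    then have "l (v - l v *\<^sub>R e + frechet_derivative Y (at p0) v *\<^sub>R e) = 0" using l by (simp add: linear_0)
    then have Yv: "frechet_derivative Y (at p0) v = 0"
      using l by (simp add: linear_add linear_diff linear_scale)
    with 0 have v: "v = l v *\<^sub>R e" by simp
    have "frechet_derivative Y (at p0) (l v *\<^sub>R e) = 0"
      by (subst v[symmetric]) (rule Yv)
    then have "l v = 0"
      using Ye linear_scale[OF smooth_on_linear_frechet_derivative[OF Y p0]] by simp
    then show "v = 0" by (subst v) simp
  qed
  obtain U V \<psi> where U: "U \<subseteq> S" "p0 \<in> U" and inv: "smooth_local_inverse U V \<Phi> \<psi>"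
    by (rule smooth_inverse_function[OF \<Phi> p0 inj])
  have \<psi>: "smooth_on V \<psi>" "\<And>y. y \<in> V \<Longrightarrow> \<psi> y \<in> S" "\<And>y. y \<in> V \<Longrightarrow> \<Phi> (\<psi> y) = y"
    and \<Phi>p0: "\<Phi> p0 \<in> V" "\<psi> (\<Phi> p0) = p0"
    using inv U by (auto simp: smooth_local_inverse_def)
  have V: "open V" using \<psi>(1) smooth_on_open by blast
  define r where "r q = l (\<psi> q) - l q" for q
  have r: "smooth_on V r" unfolding r_def[abs_def]
    by (intro smooth_on_diff smooth_on_linear_compose[OF bl] smooth_on_bounded_linear bl \<psi> V)
  have q\<psi>: "q + r q *\<^sub>R e = \<psi> q" if "q \<in> V" for q
  proof -
    have "Y (\<psi> q) = l q" using l\<Phi>[of "\<psi> q"] \<psi>(3)[OF that] by simp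
    then have "q = \<psi> q - l (\<psi> q) *\<^sub>R e + l q *\<^sub>R e" using \<psi>(3)[OF that] by (simp add: \<Phi>_def)
    then show ?thesis by (simp add: r_def algebra_simps)
  qed
  have q0: "q0 \<in> V" "q0 = \<Phi> p0" using \<Phi>p0 by (auto simp: q0_def \<Phi>_def)
  have q0p0: "q0 + r q0 *\<^sub>R e = p0" using q\<psi>[OF q0(1)] q0(2) \<Phi>p0 by simp
  have Yl: "Y (q + r q *\<^sub>R e) = l q" if "q \<in> V" for q
    using l\<Phi>[of "\<psi> q"] \<psi>(3)[OF that] q\<psi>[OF that] by simp
  \<comment> \<open>Differentiating \<open>Y (q + r q *\<^sub>R e) = l q\<close> in direction
    \<open>e\<close> gives 1 on the right, but 0 on the left if the factor vanished.\<close>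
  have "1 + frechet_derivative r (at q0) e \<noteq> 0"
  proof
    let ?r' = "frechet_derivative r (at q0)" and ?Y' = "frechet_derivative Y (at p0)"
    assume 0: "1 + ?r' e = 0"
    have "((\<lambda>q. q + r q *\<^sub>R e) has_derivative (\<lambda>v. v + ?r' v *\<^sub>R e)) (at q0)"
      by (intro derivative_intros smooth_on_has_derivative[OF r q0(1)])
    from has_derivative_compose[OF this, of Y ?Y']
    have "((\<lambda>q. Y (q + r q *\<^sub>R e)) has_derivative (\<lambda>v. ?Y' (v + ?r' v *\<^sub>R e))) (at q0)"
      using smooth_on_has_derivative[OF Y p0] by (simp add: q0p0)
    then have "(l has_derivative (\<lambda>v. ?Y' (v + ?r' v *\<^sub>R e))) (at q0)"
      by (rule has_derivative_transform_within_open[OF _ V q0(1) Yl])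
    then have "l = (\<lambda>v. ?Y' (v + ?r' v *\<^sub>R e))"
      using bounded_linear_imp_has_derivative[OF bl] has_derivative_unique by blast
    then have "l e = ?Y' ((1 + ?r' e) *\<^sub>R e)" by (simp add: algebra_simps)
    then show False using 0 l(2) linear_0[OF smooth_on_linear_frechet_derivative[OF Y p0]] by simp
  qed
  then show ?thesis
    using that[OF V q0(1) r q0p0 _ _ Yl] \<psi>(2) q\<psi> by auto
qed

text \<open>In the proof \<open>c p\<close> is the critical point of \<open>h\<close> on the line through \<open>p\<close> in
  direction \<open>e\<close>, and by Taylor's formula \<open>h p - h (c p)\<close> is, up to sign, the square of a function
  that can serve as the new coordinate.\<close>

theorem split_off_square:
  fixes e p0 :: "'a::euclidean_space" and h l :: "'a \<Rightarrow> real"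
  assumes l: "linear l" "l e = 1" "l p0 = 0" and h: "smooth_on D h" and p0: "p0 \<in> D"
    and crit: "frechet_derivative h (at p0) e = 0"
    and nondeg: "frechet_derivative (\<lambda>p. frechet_derivative h (at p) e) (at p0) e \<noteq> 0"
  obtains V r G g \<sigma> where "open V" "p0 \<in> V" "smooth_on V r" "r p0 = 0"
    "1 + frechet_derivative r (at p0) e \<noteq> 0" "\<And>q. q \<in> V \<Longrightarrow> q + r q *\<^sub>R e \<in> D"
    "smooth_on G g" "\<And>q. q \<in> V \<Longrightarrow> q - l q *\<^sub>R e \<in> G" "\<sigma> \<noteq> 0"
    "\<And>q. q \<in> V \<Longrightarrow> h (q + r q *\<^sub>R e) = g (q - l q *\<^sub>R e) + \<sigma> * (l q)\<^sup>2"
proof -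
  have bl: "bounded_linear l" using l(1) by (simp add: linear_conv_bounded_linear)
  have D: "open D" using h smooth_on_open by blast
  have e: "e \<noteq> 0" using l by (auto simp: linear_0)
  let ?pr = "\<lambda>p. p - l p *\<^sub>R e"
  have pr: "smooth_on UNIV ?pr"
    by (intro smooth_on_diff smooth_on_scaleR smooth_on_const smooth_on_bounded_linear bl
        bounded_linear_ident) auto
  have lpr: "l (?pr p) = 0" for p using l by (simp add: linear_diff linear_scale)
  have pr_add: "?pr (p + t *\<^sub>R e) = ?pr p" for p t
    using l by (simp add: linear_add linear_scale algebra_simps)
  define F where "F p = frechet_derivative h (at p) e" for p
  define Fe where "Fe p = frechet_derivative F (at p) e" for p
  have F: "smooth_on D F" unfolding F_def[abs_def] by (rule smooth_on_frechet_derivative[OF h])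
  have Fe: "smooth_on D Fe" unfolding Fe_def[abs_def] by (rule smooth_on_frechet_derivative[OF F])
  have F0: "F p0 = 0" "Fe p0 \<noteq> 0" using crit nondeg by (auto simp: F_def[abs_def] Fe_def)
  have Fe0: "frechet_derivative F (at p0) e \<noteq> 0" and p0F: "p0 = p0 - l p0 *\<^sub>R e + F p0 *\<^sub>R e"
    using F0 l(3) by (simp_all add: Fe_def)
  \<comment> \<open>First use of \<open>solve_coordinate\<close>: with \<open>F\<close> as the
    coordinate, points with \<open>l q = 0\<close> are moved to zeros of the derivative along
    \<open>e\<close>.\<close>
  obtain V1 r1 where V1: "open V1" "p0 \<in> V1" "smooth_on V1 r1" "p0 + r1 p0 *\<^sub>R e = p0"
    "\<And>q. q \<in> V1 \<Longrightarrow> q + r1 q *\<^sub>R e \<in> D" "\<And>q. q \<in> V1 \<Longrightarrow> F (q + r1 q *\<^sub>R e) = l q"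
    by (rule solve_coordinate[OF l(1,2) F p0 Fe0 p0F]) blast
  have r10: "r1 p0 = 0" using V1(4) e by simp
  define V1' where "V1' = {p. ?pr p \<in> V1}"
  have V1': "open V1'" "p0 \<in> V1'"
    using open_Collect_mem_continuous_on[OF smooth_on_continuous_on[OF pr] open_UNIV V1(1)] V1(2) l(3)
    by (auto simp: V1'_def)
  \<comment> \<open>Both are built from \<open>?pr p\<close>, so \<open>c\<close> is constant along
    lines in direction \<open>e\<close>, and \<open>s p\<close> is the signed parameter of
    \<open>p\<close> on its line measured from \<open>c p\<close>.\<close>
  define c where "c p = ?pr p + r1 (?pr p) *\<^sub>R e" for p
  define s where "s p = l p - r1 (?pr p)" for p
  have pr': "smooth_on V1' ?pr" using pr V1'(1) by (rule smooth_on_subset) auto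
  have r1': "smooth_on V1' (\<lambda>p. r1 (?pr p))"
    by (rule smooth_on_compose[OF V1(3) pr']) (simp add: V1'_def)
  have c: "smooth_on V1' c" unfolding c_def[abs_def]
    by (intro smooth_on_add smooth_on_scaleR pr' r1' smooth_on_const V1')
  have s: "smooth_on V1' s" unfolding s_def[abs_def]
    by (intro smooth_on_diff smooth_on_bounded_linear bl r1' V1')
  have c0: "c p0 = p0" and s0: "s p0 = 0" using l(3) r10 by (simp_all add: c_def s_def)
  have cs: "p = c p + s p *\<^sub>R e" for p by (simp add: c_def s_def algebra_simps)
  have Fc: "F (c p) = 0" if "p \<in> V1'" for p
    using V1(6)[of "?pr p"] lpr[of p] that unfolding V1'_def c_def by simp
  have c_add: "c (p + t *\<^sub>R e) = c p" for p t unfolding c_def pr_add ..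
  obtain \<rho> where \<rho>: "\<rho> > 0" "ball p0 \<rho> \<subseteq> D" using D p0 open_contains_ball by blast
  \<comment> \<open>With \<open>\<bar>t\<bar> < 2\<close> the displacement from \<open>c p\<close>
    has norm at most \<open>\<rho>/2\<close>, which together with the radius \<open>\<rho>/2\<close>
    for \<open>c p\<close> stays in the ball. The range of \<open>t\<close> is an open interval
    around the unit interval, as the parameter integral requires.\<close>
  define W where "W = {p \<in> V1'. (c p, s p) \<in> ball p0 (\<rho>/2) \<times> {a. \<bar>a\<bar> < \<rho> / (4 * norm e)}}"
  have W: "open W" unfolding W_def
  proof (rule open_Collect_mem_continuous_on)
    show "continuous_on V1' (\<lambda>p. (c p, s p))"
      using c s by (intro continuous_on_Pair smooth_on_continuous_on)
    show "open (ball p0 (\<rho>/2) \<times> {a::real. \<bar>a\<bar> < \<rho> / (4 * norm e)})"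
      by (intro open_Times open_Collect_less continuous_intros) auto
  qed (rule V1')
  have p0W: "p0 \<in> W" using V1' c0 s0 \<rho> e by (simp add: W_def)
  have seg: "c p + (t * s p) *\<^sub>R e \<in> D" if "p \<in> W" "t \<in> {-2<..<2}" for p t
  proof -
    have "\<bar>t\<bar> * \<bar>s p\<bar> * norm e \<le> 2 * (\<rho> / (4 * norm e)) * norm e"
      using that by (intro mult_right_mono mult_mono) (auto simp: W_def)
    then have "norm ((t * s p) *\<^sub>R e) \<le> \<rho>/2" using e by (simp add: abs_mult)
    moreover have "norm (c p - p0) < \<rho>/2" using that by (simp add: W_def dist_norm norm_minus_commute)
    ultimately have "norm ((c p - p0) + (t * s p) *\<^sub>R e) < \<rho>"
      using norm_triangle_ineq[of "c p - p0" "(t * s p) *\<^sub>R e"] by linarith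
    then have "c p + (t * s p) *\<^sub>R e \<in> ball p0 \<rho>"
      by (simp add: dist_norm norm_minus_commute algebra_simps)
    then show ?thesis using \<rho> by blast
  qed
  let ?T = "{-2<..<2::real}"
  \<comment> \<open>The integral is a smooth substitute for the quotient of
    \<open>h p - h (c p)\<close> by \<open>(s p)\<^sup>2\<close>, also where
    \<open>s p = 0\<close>.\<close>
  define a where "a p = integral {0..1} (\<lambda>t. (1 - t) * Fe (c p + (t * s p) *\<^sub>R e))" for p
  have a: "smooth_on W a"
  proof -
    have WT: "open (W \<times> ?T)" using W by (intro open_Times) auto
    have fs: "smooth_on (W \<times> ?T) (\<lambda>z. f (fst z))" if "smooth_on V1' f" for f :: "'a \<Rightarrow> 'b::real_normed_vector"
      by (rule smooth_on_compose[OF that smooth_on_bounded_linear[OF bounded_linear_fst WT]])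
        (auto simp: W_def)
    have sn: "smooth_on (W \<times> ?T) snd" by (rule smooth_on_bounded_linear[OF bounded_linear_snd WT])
    have "smooth_on (W \<times> ?T) (\<lambda>z. c (fst z) + (snd z * s (fst z)) *\<^sub>R e)"
      by (intro smooth_on_add smooth_on_scaleR smooth_on_mult fs c s sn smooth_on_const WT)
    then have "smooth_on (W \<times> ?T) (\<lambda>z. Fe (c (fst z) + (snd z * s (fst z)) *\<^sub>R e))"
      by (rule smooth_on_compose[OF Fe]) (auto intro: seg)
    then have "smooth_on (W \<times> ?T) (\<lambda>z. (1 - snd z) * Fe (c (fst z) + (snd z * s (fst z)) *\<^sub>R e))"
      by (intro smooth_on_mult smooth_on_diff smooth_on_const WT sn)
    moreover have "{0..1} \<subseteq> ?T" by auto
    ultimately show ?thesis using smooth_on_integral[OF _ W] by (fastforce simp: a_def[abs_def])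
  qed
  have h_eq: "h p = h (c p) + (s p)\<^sup>2 * a p" if "p \<in> W" for p
  proof -
    have "p \<in> V1'" using that by (simp add: W_def)
    from taylor_critical_line[OF h, of "c p" e "s p"] Fc[OF this] seg[OF that]
    have "h (c p + s p *\<^sub>R e) = h (c p) + (s p)\<^sup>2 * a p"
      by (simp add: a_def F_def[abs_def] Fe_def)
    then show ?thesis by (simp flip: cs)
  qed
  have a0: "a p0 = Fe p0 / 2"
  proof -
    have "((\<lambda>t. (1 - t) * Fe p0) has_integral (1 - 1\<^sup>2/2) * Fe p0 - (0 - 0\<^sup>2/2) * Fe p0) {0..1::real}"
    proof (rule fundamental_theorem_of_calculus)
      show "((\<lambda>t. (t - t\<^sup>2/2) * Fe p0) has_vector_derivative (1 - t) * Fe p0) (at t within {0..1})" for t :: real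
        unfolding has_real_derivative_iff_has_vector_derivative[symmetric]
        by (auto intro!: derivative_eq_intros)
    qed simp
    from integral_unique[OF this] show ?thesis by (simp add: a_def c0 s0)
  qed
  \<comment> \<open>The sign makes \<open>\<sigma> * a\<close> positive near \<open>p0\<close>,
    where its square root is smooth.\<close>
  define \<sigma> where "\<sigma> = sgn (Fe p0)"
  have \<sigma>: "\<sigma> \<noteq> 0" "\<sigma> * \<sigma> = 1" "\<sigma> * a p0 > 0"
    using F0 a0 by (auto simp: \<sigma>_def sgn_if)
  define W' where "W' = {p \<in> W. \<sigma> * a p \<in> {0<..}}"
  have "continuous_on W (\<lambda>p. \<sigma> * a p)"
    using a by (intro continuous_intros smooth_on_continuous_on)
  then have W': "open W'" unfolding W'_def
    by (rule open_Collect_mem_continuous_on[OF _ W]) simp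
  have p0W': "p0 \<in> W'" using p0W \<sigma> by (simp add: W'_def)
  define b where "b p = sqrt (\<sigma> * a p)" for p
  have b: "smooth_on W' b" unfolding b_def[abs_def]
    using smooth_on_subset[OF a W'] W'
    by (intro smooth_on_sqrt smooth_on_mult smooth_on_const) (auto simp: W'_def)
  have s': "smooth_on W' s" using s W' by (rule smooth_on_subset) (auto simp: W'_def W_def)
  define Y where "Y p = s p * b p" for p
  have Y: "smooth_on W' Y" unfolding Y_def[abs_def] using s' b by (rule smooth_on_mult)
  have h_eq': "h p = h (c p) + \<sigma> * (Y p)\<^sup>2" if "p \<in> W'" for p
  proof -
    have "\<sigma> * (Y p)\<^sup>2 = \<sigma> * (s p)\<^sup>2 * (\<sigma> * a p)"
      using that by (simp add: Y_def b_def power_mult_distrib W'_def)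
    also have "\<dots> = (\<sigma> * \<sigma>) * ((s p)\<^sup>2 * a p)" by (simp add: algebra_simps)
    finally show ?thesis using h_eq that \<sigma>(2) by (simp add: W'_def)
  qed
  \<comment> \<open>On the line through \<open>p0\<close> the function \<open>s\<close> is the line
    parameter, so \<open>Y\<close> is \<open>t\<close> times \<open>b\<close> there and its
    derivative at 0 is \<open>b p0 > 0\<close>.\<close>
  have Ye: "frechet_derivative Y (at p0) e \<noteq> 0"
  proof -
    have s_line: "s (p0 + t *\<^sub>R e) = t" for t
      using l r10 unfolding s_def pr_add by (simp add: linear_add linear_scale)
    have 1: "((\<lambda>t. Y (p0 + t *\<^sub>R e)) has_real_derivative frechet_derivative Y (at p0) e) (at 0)"
      using smooth_on_has_real_derivative_line[OF Y, of p0 0 e] p0W' by simp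
    have "((\<lambda>t. b (p0 + t *\<^sub>R e)) has_real_derivative frechet_derivative b (at p0) e) (at 0)"
      using smooth_on_has_real_derivative_line[OF b, of p0 0 e] p0W' by simp
    from DERIV_mult[OF DERIV_ident this]
    have "((\<lambda>t. Y (p0 + t *\<^sub>R e)) has_real_derivative b p0) (at 0)"
      by (simp add: Y_def s_line)
    with 1 have "frechet_derivative Y (at p0) e = b p0" by (rule DERIV_unique)
    then show ?thesis using \<sigma>(3) by (auto simp: b_def)
  qed
  have p0Y: "p0 = p0 - l p0 *\<^sub>R e + Y p0 *\<^sub>R e" using s0 l(3) by (simp add: Y_def)
  \<comment> \<open>Second use of \<open>solve_coordinate\<close>: the signed root \<open>Y\<close>
    becomes the coordinate \<open>l\<close>.\<close>
  obtain V r where V: "open V" "p0 \<in> V" "smooth_on V r" "p0 + r p0 *\<^sub>R e = p0"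
    "1 + frechet_derivative r (at p0) e \<noteq> 0"
    "\<And>q. q \<in> V \<Longrightarrow> q + r q *\<^sub>R e \<in> W'" "\<And>q. q \<in> V \<Longrightarrow> Y (q + r q *\<^sub>R e) = l q"
    by (rule solve_coordinate[OF l(1,2) Y p0W' Ye p0Y]) blast
  have r0: "r p0 = 0" using V(4) e by simp
  \<comment> \<open>On the hyperplane \<open>l p = 0\<close> this is the value of \<open>h\<close>
    at the critical point of the line through \<open>p\<close>.\<close>
  define g where "g p = h (p + r1 p *\<^sub>R e)" for p
  have g: "smooth_on V1 g" unfolding g_def[abs_def]
    by (intro smooth_on_compose[OF h] smooth_on_add smooth_on_scaleR V1 smooth_on_const
        smooth_on_bounded_linear[OF bounded_linear_ident])
  have W'D: "W' \<subseteq> D" using seg[of _ 1] cs by (auto simp: W'_def)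
  show ?thesis
  proof (rule that[OF V(1-3) r0 V(5) _ g _ \<sigma>(1)])
    fix q assume q: "q \<in> V"
    show "q + r q *\<^sub>R e \<in> D" using V(6)[OF q] W'D by blast
    have "q + r q *\<^sub>R e \<in> V1'" using V(6)[OF q] by (simp add: W'_def W_def)
    then show "q - l q *\<^sub>R e \<in> V1" unfolding V1'_def mem_Collect_eq pr_add .
    show "h (q + r q *\<^sub>R e) = g (q - l q *\<^sub>R e) + \<sigma> * (l q)\<^sup>2"
      using h_eq'[OF V(6)[OF q]] V(7)[OF q] unfolding c_add by (simp add: g_def c_def)
  qed
qed

section \<open>Splitting families\<close>

text \<open>The projection \<open>P\<close> stands for the part of the coordinates not yet split off: the squares are
  collected in \<open>B\<close>, whose radical is exactly the range of \<open>P\<close>. This avoids choosing coordinates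
  adapted to the Hessian before the end of the induction. Only the second component of the
  fibre-preserving map \<open>z \<mapsto> (fst z, \<theta> z)\<close> is recorded.\<close>

definition splitting ::
  "('m::euclidean_space \<times> 'a::euclidean_space \<Rightarrow> real) \<Rightarrow> ('m \<times> 'a) set \<Rightarrow> 'm \<Rightarrow> 'a \<Rightarrow>
   ('m \<times> 'a) set \<Rightarrow> ('m \<times> 'a \<Rightarrow> 'a) \<Rightarrow> ('m \<times> 'a) set \<Rightarrow> ('m \<times> 'a \<Rightarrow> real) \<Rightarrow>
   ('a \<Rightarrow> 'a) \<Rightarrow> ('a \<Rightarrow> 'a \<Rightarrow> real) \<Rightarrow> bool" where
  "splitting h D m0 q0 E \<theta> G g P B \<longleftrightarrow>
     smooth_on E \<theta> \<and> (m0, 0) \<in> E \<and> \<theta> (m0, 0) = q0 \<and> (\<forall>z\<in>E. (fst z, \<theta> z) \<in> D) \<and>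
     (\<forall>v. frechet_derivative \<theta> (at (m0, 0)) (0, v) = 0 \<longrightarrow> v = 0) \<and>
     smooth_on G g \<and> (\<forall>z\<in>E. (fst z, P (snd z)) \<in> G) \<and>
     linear P \<and> (\<forall>v. P (P v) = P v) \<and> bilinear B \<and> (\<forall>v w. B v w = B w v) \<and>
     (\<forall>v. P v = v \<longleftrightarrow> (\<forall>w. B v w = 0)) \<and>
     (\<forall>z\<in>E. h (fst z, \<theta> z) = g (fst z, P (snd z)) + B (snd z) (snd z))"

lemma bounded_linear_on_snd: "linear L \<Longrightarrow> bounded_linear (\<lambda>z. L (snd z))"
  for L :: "'a::euclidean_space \<Rightarrow> 'b::euclidean_space"
  by (rule bounded_linear_compose[OF _ bounded_linear_snd]) (simp add: linear_conv_bounded_linear)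

lemma smooth_on_parameter_Pair:
  "smooth_on E f \<Longrightarrow> smooth_on E (\<lambda>z. (fst z, f z))"
  by (intro smooth_on_Pair smooth_on_bounded_linear[OF bounded_linear_fst] smooth_on_open)

lemma frechet_derivative_parameter_Pair:
  assumes "smooth_on D h" "smooth_on E \<theta>" "z \<in> E" "(fst z, \<theta> z) \<in> D"
  shows "frechet_derivative (\<lambda>z. h (fst z, \<theta> z)) (at z) w
    = frechet_derivative h (at (fst z, \<theta> z)) (fst w, frechet_derivative \<theta> (at z) w)"
proof -
  have "((\<lambda>z. (fst z, \<theta> z)) has_derivative (\<lambda>w. (fst w, frechet_derivative \<theta> (at z) w))) (at z)"
    using smooth_on_has_derivative[OF assms(2,3)] by (auto intro!: derivative_eq_intros)
  from has_derivative_compose[OF this smooth_on_has_derivative[OF assms(1,4)]]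
  show ?thesis by (simp flip: frechet_derivative_at)
qed

text \<open>Start of the induction: no square is split off, so \<open>P\<close> is the identity and
  \<open>B\<close> is zero.\<close>

lemma trivial_splitting:
  fixes h :: "'m::euclidean_space \<times> 'a::euclidean_space \<Rightarrow> real"
  assumes "smooth_on D h" "(m0, q0) \<in> D"
  shows "\<exists>E \<theta> G g P B. splitting h D m0 q0 E \<theta> G g P B"
proof -
  define \<theta> where "\<theta> = (\<lambda>z::'m \<times> 'a. q0 + snd z)"
  have \<theta>: "smooth_on UNIV \<theta>" unfolding \<theta>_def
    by (intro smooth_on_add smooth_on_const smooth_on_bounded_linear[OF bounded_linear_snd]) auto
  define E where "E = {z. (fst z, \<theta> z) \<in> D}"
  have "open E" unfolding E_def
    using open_Collect_mem_continuous_on[OF smooth_on_continuous_on[OF smooth_on_parameter_Pair[OF \<theta>]]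
        open_UNIV smooth_on_open[OF assms(1)]] by simp
  then have \<theta>': "smooth_on E \<theta>" using smooth_on_subset[OF \<theta>] by simp
  then have g: "smooth_on E (\<lambda>z. h (fst z, \<theta> z))"
    by (intro smooth_on_compose[OF assms(1)] smooth_on_parameter_Pair) (auto simp: E_def)
  have "(\<theta> has_derivative snd) (at z)" for z unfolding \<theta>_def
    by (auto intro!: derivative_eq_intros)
  then have "frechet_derivative \<theta> (at z) = snd" for z
    using frechet_derivative_at by metis
  then have "splitting h D m0 q0 E \<theta> E (\<lambda>z. h (fst z, \<theta> z)) (\<lambda>v. v) (\<lambda>v w. 0)"
    using \<theta>' g assms(2)
    by (auto simp: splitting_def E_def \<theta>_def bilinear_def linear_iff)
  then show ?thesis by blast
qed

text \<open>A vector fixed by \<open>P\<close> lies in the radical of \<open>B\<close>, so along the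
  line in direction \<open>(0, e)\<close> the residual function coincides with the transformed
  \<open>h\<close>, whose fibre derivative at the base point is zero.\<close>

lemma splitting_reduced_critical:
  assumes h: "smooth_on D h" and crit: "\<And>v. frechet_derivative h (at (m0, q0)) (0, v) = 0"
    and sp: "splitting h D m0 q0 E \<theta> G g P B" and e: "P e = e"
  shows "frechet_derivative g (at (m0, 0)) (0, e) = 0"
proof -
  have \<theta>: "smooth_on E \<theta>" and z0: "(m0, 0) \<in> E" and \<theta>0: "\<theta> (m0, 0) = q0"
    and D: "\<And>z. z \<in> E \<Longrightarrow> (fst z, \<theta> z) \<in> D" and g: "smooth_on G g"
    and G: "\<And>z. z \<in> E \<Longrightarrow> (fst z, P (snd z)) \<in> G" and P: "linear P" and B: "bilinear B"
    and h_eq: "\<And>z. z \<in> E \<Longrightarrow> h (fst z, \<theta> z) = g (fst z, P (snd z)) + B (snd z) (snd z)"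
    and Be: "\<And>w. B e w = 0"
    using sp e unfolding splitting_def by auto
  let ?k = "\<lambda>z. h (fst z, \<theta> z)"
  have k: "smooth_on E ?k"
    by (rule smooth_on_compose[OF h smooth_on_parameter_Pair[OF \<theta>]]) (rule D)
  have "frechet_derivative ?k (at (m0, 0)) (0, e) = 0"
    using frechet_derivative_parameter_Pair[OF h \<theta> z0 D[OF z0]] crit by (simp add: \<theta>0)
  then have 1: "((\<lambda>t. ?k ((m0, 0) + t *\<^sub>R (0, e))) has_real_derivative 0) (at 0)"
    using smooth_on_has_real_derivative_line[OF k, of "(m0, 0)" 0 "(0, e)"] z0 by simp
  have "(m0, 0) \<in> G" using G[OF z0] P by (simp add: linear_0)
  then have 2: "((\<lambda>t. g ((m0, 0) + t *\<^sub>R (0, e))) has_real_derivative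
      frechet_derivative g (at (m0, 0)) (0, e)) (at 0)"
    using smooth_on_has_real_derivative_line[OF g, of "(m0, 0)" 0 "(0, e)"] by simp
  have "continuous_on UNIV (\<lambda>t. (m0, 0) + t *\<^sub>R (0, e))" by (intro continuous_intros)
  then have opn: "open {t \<in> UNIV. (m0, 0) + t *\<^sub>R (0, e) \<in> E}"
    by (rule open_Collect_mem_continuous_on) (use \<theta> smooth_on_open in auto)
  have "((\<lambda>t. g ((m0, 0) + t *\<^sub>R (0, e))) has_real_derivative 0) (at 0)"
  proof (rule has_field_derivative_transform_within_open[OF 1 opn])
    fix t assume "t \<in> {t \<in> UNIV. (m0, 0) + t *\<^sub>R (0, e) \<in> E}"
    then show "?k ((m0, 0) + t *\<^sub>R (0, e)) = g ((m0, 0) + t *\<^sub>R (0, e))"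
      using h_eq[of "(m0, t *\<^sub>R e)"] P e Be B
      by (simp add: linear_scale bilinear_lmul)
  qed (use z0 in simp)
  with 2 show ?thesis by (rule DERIV_unique)
qed

text \<open>One square is split off the residual function. Subtracting the
  \<open>e\<close>-component from \<open>P\<close> and adding \<open>\<sigma>\<close> times the
  square of \<open>l\<close> to \<open>B\<close> keeps the radical of the form equal to the range of
  the projection.\<close>

lemma splitting_step:
  fixes h :: "'m::euclidean_space \<times> 'a::euclidean_space \<Rightarrow> real"
  assumes h: "smooth_on D h" and crit: "\<And>v. frechet_derivative h (at (m0, q0)) (0, v) = 0"
    and sp: "splitting h D m0 q0 E \<theta> G g P B" and e: "P e = e"
    and nondeg: "frechet_derivative (\<lambda>z. frechet_derivative g (at z) (0, e)) (at (m0, 0)) (0, e) \<noteq> 0"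
  shows "\<exists>E' \<theta>' G' g' P' B'. splitting h D m0 q0 E' \<theta>' G' g' P' B' \<and> dim (range P') < dim (range P)"
proof -
  have \<theta>: "smooth_on E \<theta>" and z0: "(m0, 0) \<in> E" and \<theta>0: "\<theta> (m0, 0) = q0"
    and D: "\<And>z. z \<in> E \<Longrightarrow> (fst z, \<theta> z) \<in> D"
    and inj: "\<And>v. frechet_derivative \<theta> (at (m0, 0)) (0, v) = 0 \<Longrightarrow> v = 0"
    and g: "smooth_on G g"
    and G: "\<And>z. z \<in> E \<Longrightarrow> (fst z, P (snd z)) \<in> G"
    and P: "linear P" and PP: "\<And>v. P (P v) = P v"
    and B: "bilinear B" and Bsym: "\<And>v w. B v w = B w v"
    and rad: "\<And>v. P v = v \<longleftrightarrow> (\<forall>w. B v w = 0)"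
    and h_eq: "\<And>z. z \<in> E \<Longrightarrow> h (fst z, \<theta> z) = g (fst z, P (snd z)) + B (snd z) (snd z)"
    using sp unfolding splitting_def by blast+
  have zG: "(m0, 0) \<in> G" using G[OF z0] P by (simp add: linear_0)
  have "e \<noteq> 0"
  proof
    assume "e = 0"
    then show False
      using nondeg linear_0[OF smooth_on_linear_frechet_derivative[OF smooth_on_frechet_derivative[OF g] zG]]
      by (simp flip: zero_prod_def)
  qed
  \<comment> \<open>A functional that factors through \<open>P\<close>, so that it sees only
    coordinates not yet split off, normalised to 1 at \<open>e\<close>.\<close>
  define l where "l v = (e \<bullet> P v) / (e \<bullet> e)" for v
  have l: "linear l" using P
    by (auto simp: l_def linear_iff inner_add_right add_divide_distrib)
  have le: "l e = 1" using \<open>e \<noteq> 0\<close> e by (simp add: l_def)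
  have lP: "l (P v) = l v" for v by (simp add: l_def PP)
  let ?l = "\<lambda>z::'m \<times> 'a. l (snd z)"
  have ll: "linear ?l" using bounded_linear_on_snd[OF l] by (simp add: linear_conv_bounded_linear)
  have l0: "?l (m0, 0) = 0" using l by (simp add: linear_0)
  have le': "?l (0, e) = 1" using le by simp
  obtain V r G' g' \<sigma> where V: "open V" "(m0, 0) \<in> V" "smooth_on V r" "r (m0, 0) = 0"
    "1 + frechet_derivative r (at (m0, 0)) (0, e) \<noteq> 0"
    "smooth_on G' g'" "\<And>q. q \<in> V \<Longrightarrow> q - ?l q *\<^sub>R (0, e) \<in> G'" "\<sigma> \<noteq> 0"
    "\<And>q. q \<in> V \<Longrightarrow> g (q + r q *\<^sub>R (0, e)) = g' (q - ?l q *\<^sub>R (0, e)) + \<sigma> * (?l q)\<^sup>2"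
    by (rule split_off_square[OF ll le' l0 g zG splitting_reduced_critical[OF h crit sp e] nondeg]) blast
  define P' where "P' v = P v - l v *\<^sub>R e" for v
  define B' where "B' v w = B v w + \<sigma> * (l v * l w)" for v w
  let ?\<pi> = "\<lambda>z::'m \<times> 'a. (fst z, P (snd z))"
  \<comment> \<open>The displacement is evaluated at the projected point, so that
    \<open>P (s z)\<close> is the point \<open>q + r q *\<^sub>R e\<close> of the one-square theorem
    with \<open>q = ?\<pi> z\<close>.\<close>
  define s where "s z = snd z + r (?\<pi> z) *\<^sub>R e" for z
  define W where "W = {z \<in> UNIV. ?\<pi> z \<in> V}"
  have bP: "bounded_linear (\<lambda>z::'m \<times> 'a. P (snd z))" by (rule bounded_linear_on_snd[OF P])
  have \<pi>: "smooth_on UNIV ?\<pi>"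
    by (intro smooth_on_parameter_Pair smooth_on_bounded_linear[OF bP]) auto
  have W: "open W" unfolding W_def
    by (rule open_Collect_mem_continuous_on[OF smooth_on_continuous_on[OF \<pi>] _ V(1)]) auto
  have s: "smooth_on W s" unfolding s_def[abs_def]
    by (intro smooth_on_add smooth_on_scaleR smooth_on_const W
        smooth_on_bounded_linear[OF bounded_linear_snd] smooth_on_compose[OF V(3)] smooth_on_subset[OF \<pi>])
      (auto simp: W_def)
  define E' where "E' = {z \<in> W. (fst z, s z) \<in> E}"
  have E': "open E'" unfolding E'_def
    by (rule open_Collect_mem_continuous_on[OF smooth_on_continuous_on[OF smooth_on_parameter_Pair[OF s]] W])
      (use \<theta> smooth_on_open in auto)
  have s': "smooth_on E' s" using s E' by (rule smooth_on_subset) (auto simp: E'_def)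
  have s0: "s (m0, 0) = 0" using P V(4) by (simp add: s_def linear_0)
  have z0': "(m0, 0) \<in> E'" using V(2) P z0 s0 by (simp add: E'_def W_def linear_0)
  define \<theta>' where "\<theta>' z = \<theta> (fst z, s z)" for z
  have \<theta>': "smooth_on E' \<theta>'" unfolding \<theta>'_def[abs_def]
    by (rule smooth_on_compose[OF \<theta> smooth_on_parameter_Pair[OF s']]) (simp add: E'_def)
  have inj': "v = 0" if v: "frechet_derivative \<theta>' (at (m0, 0)) (0, v) = 0" for v
  proof -
    let ?r' = "frechet_derivative r (at (m0, 0))"
    have "(?\<pi> has_derivative (\<lambda>w. (fst w, P (snd w)))) (at (m0, 0))"
      by (intro derivative_intros bounded_linear_imp_has_derivative[OF bP])
    from has_derivative_compose[OF this, of r ?r']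
    have "((\<lambda>z. r (?\<pi> z)) has_derivative (\<lambda>w. ?r' (fst w, P (snd w)))) (at (m0, 0))"
      using smooth_on_has_derivative[OF V(3,2)] P by (simp add: linear_0)
    then have "(s has_derivative (\<lambda>w. snd w + ?r' (fst w, P (snd w)) *\<^sub>R e)) (at (m0, 0))"
      unfolding s_def[abs_def] by (intro derivative_intros)
    from frechet_derivative_at[OF this, symmetric]
    have ds: "frechet_derivative s (at (m0, 0)) (0, v) = v + ?r' (0, P v) *\<^sub>R e" by simp
    have "frechet_derivative \<theta>' (at (m0, 0)) (0, v)
        = frechet_derivative \<theta> (at (m0, 0)) (0, v + ?r' (0, P v) *\<^sub>R e)"
      unfolding \<theta>'_def[abs_def]
      using frechet_derivative_parameter_Pair[OF \<theta> s' z0'] z0 by (simp add: s0 ds)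
    then have "v + ?r' (0, P v) *\<^sub>R e = 0" using inj v by metis
    then have ve: "v = - ?r' (0, P v) *\<^sub>R e" by (simp add: eq_neg_iff_add_eq_0)
    \<comment> \<open>A kernel vector must be a multiple of \<open>e\<close>, and the nonzero factor
      \<open>1 + ?r' (0, e)\<close> forces the multiple to be zero.\<close>
    define t where "t = - ?r' (0, P v)"
    have vt: "v = t *\<^sub>R e" using ve by (simp add: t_def)
    have "?r' (0, P v) = ?r' (t *\<^sub>R (0, e))" unfolding vt using P e by (simp add: linear_scale)
    also have "\<dots> = t * ?r' (0, e)"
      using linear_scale[OF smooth_on_linear_frechet_derivative[OF V(3,2)], of t "(0, e)"] by simp
    finally have "t * (1 + ?r' (0, e)) = 0" by (simp add: t_def algebra_simps)
    then show "v = 0" using V(5) vt by simp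
  qed
  have h_eq': "h (fst z, \<theta>' z) = g' (fst z, P' (snd z)) + B' (snd z) (snd z)"
    and G': "(fst z, P' (snd z)) \<in> G'" if z: "z \<in> E'" for z
  proof -
    have \<pi>z: "?\<pi> z \<in> V" and sz: "(fst z, s z) \<in> E" using z by (auto simp: E'_def W_def)
    have *: "?\<pi> z - ?l (?\<pi> z) *\<^sub>R (0, e) = (fst z, P' (snd z))" by (simp add: lP P'_def)
    show "(fst z, P' (snd z)) \<in> G'" using V(7)[OF \<pi>z] unfolding * .
    have Be: "B e w = 0" "B w e = 0" for w using rad e Bsym by metis+
    have "B (s z) (s z) = B (snd z) (snd z)"
      using B by (simp add: s_def bilinear_ladd bilinear_radd bilinear_lmul bilinear_rmul Be)
    moreover have "(fst z, P (s z)) = ?\<pi> z + r (?\<pi> z) *\<^sub>R (0, e)"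
      using P e by (simp add: s_def linear_add linear_scale)
    ultimately have "h (fst z, \<theta>' z) = g (?\<pi> z + r (?\<pi> z) *\<^sub>R (0, e)) + B (snd z) (snd z)"
      using h_eq[OF sz] by (simp add: \<theta>'_def)
    then show "h (fst z, \<theta>' z) = g' (fst z, P' (snd z)) + B' (snd z) (snd z)"
      unfolding V(9)[OF \<pi>z] * by (simp add: lP B'_def power2_eq_square)
  qed
  have P': "linear P'" using P l
    by (auto simp: P'_def linear_iff algebra_simps)
  have lP': "l (P' v) = 0" for v
    using l le lP by (simp add: P'_def linear_diff linear_scale)
  have PP': "P (P' v) = P' v" for v
    using P e PP by (simp add: P'_def linear_diff linear_scale)
  have P'P': "P' (P' v) = P' v" for v
    unfolding P'_def[of "P' v"] lP' PP' by simp
  have rad': "P' v = v \<longleftrightarrow> (\<forall>w. B' v w = 0)" for v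
  proof
    assume v: "P' v = v"
    then have "l v = 0" "P v = v" using lP' PP' by metis+
    then show "\<forall>w. B' v w = 0" using rad by (simp add: B'_def)
  next
    assume 0: "\<forall>w. B' v w = 0"
    \<comment> \<open>Since \<open>e\<close> is in the radical of \<open>B\<close>, testing
      \<open>B'\<close> against \<open>e\<close> isolates \<open>\<sigma> * l v\<close>.\<close>
    have "B v e = 0" using rad e Bsym by metis
    then have "l v = 0" using 0[rule_format, of e] V(8) le by (simp add: B'_def)
    then have "P v = v" using 0 rad by (simp add: B'_def)
    then show "P' v = v" using \<open>l v = 0\<close> by (simp add: P'_def)
  qed
  have B': "bilinear B'"
    using B l by (simp add: bilinear_def B'_def linear_iff algebra_simps)
  have "splitting h D m0 q0 E' \<theta>' G' g' P' B'"
    unfolding splitting_def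
    using \<theta>' z0' s0 \<theta>0 D inj' V(6) G' P' P'P' B' Bsym rad' h_eq'
    by (auto simp: \<theta>'_def E'_def B'_def)
  moreover have "range P' \<subset> range P"
  proof
    show "range P' \<subseteq> range P" using PP' by (metis image_subsetI rangeI)
    have "e \<in> range P" using e by (metis rangeI)
    moreover have "e \<notin> range P'" using lP' le by auto
    ultimately show "range P' \<noteq> range P" by blast
  qed
  then have "dim (range P') < dim (range P)"
    using P P' by (metis dim_psubset span_eq_iff linear_subspace_image subspace_UNIV)
  ultimately show ?thesis by blast
qed

text \<open>The process stops because each step lowers \<open>dim (range P)\<close>. Only diagonal
  second derivatives are recorded as zero, since a single nonzero diagonal value is what permits a
  further step.\<close>

lemma complete_splitting:
  fixes h :: "'m::euclidean_space \<times> 'a::euclidean_space \<Rightarrow> real"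
  assumes h: "smooth_on D h" and z0: "(m0, q0) \<in> D"
    and crit: "\<And>v. frechet_derivative h (at (m0, q0)) (0, v) = 0"
  obtains E \<theta> G g P B where "splitting h D m0 q0 E \<theta> G g P B"
    "\<And>e. P e = e \<Longrightarrow>
      frechet_derivative (\<lambda>z. frechet_derivative g (at z) (0, e)) (at (m0, 0)) (0, e) = 0"
proof -
  have "\<exists>E \<theta> G g P B. splitting h D m0 q0 E \<theta> G g P B \<and> (\<forall>e. P e = e \<longrightarrow>
      frechet_derivative (\<lambda>z. frechet_derivative g (at z) (0, e)) (at (m0, 0)) (0, e) = 0)"
    if "splitting h D m0 q0 E \<theta> G g P B" for E \<theta> G g P B
    using that
  proof (induction "dim (range P)" arbitrary: E \<theta> G g P B rule: less_induct)
    case less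
    show ?case
    proof (rule ccontr)
      assume contr: "\<not> ?case"
      then obtain e where "P e = e"
        "frechet_derivative (\<lambda>z. frechet_derivative g (at z) (0, e)) (at (m0, 0)) (0, e) \<noteq> 0"
        using less.prems by blast
      from splitting_step[OF h crit less.prems this]
      obtain E' \<theta>' G' g' P' B' where
        "splitting h D m0 q0 E' \<theta>' G' g' P' B'" "dim (range P') < dim (range P)"
        by (elim exE conjE)
      from less.hyps[OF this(2,1)] contr show False by simp
    qed
  qed
  then show ?thesis using trivial_splitting[OF h z0] that by blast
qed

section \<open>From splittings to normal forms\<close>

lemma dim_idempotent:
  fixes P :: "'a::euclidean_space \<Rightarrow> 'a"
  assumes P: "linear P" and PP: "\<And>v. P (P v) = P v"
  shows "dim (range P) + dim (range (\<lambda>v. v - P v)) = DIM('a)"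
proof -
  have R: "linear (\<lambda>v. v - P v)" using P by (intro linear_compose_sub linear_ident)
  have sum: "{x + y |x y. x \<in> range P \<and> y \<in> range (\<lambda>v. v - P v)} = UNIV"
  proof (rule UNIV_eq_I[symmetric])
    fix v
    have "v = P v + (v - P v)" by simp
    then show "v \<in> {x + y |x y. x \<in> range P \<and> y \<in> range (\<lambda>v. v - P v)}" by blast
  qed
  have "x = 0" if "x \<in> range P" "x \<in> range (\<lambda>v. v - P v)" for x
  proof -
    have "P x = x" "P x = 0" using that P PP by (auto simp: linear_diff)
    then show ?thesis by simp
  qed
  then have "range P \<inter> range (\<lambda>v. v - P v) \<subseteq> {0}" by blast
  then have dim0: "dim (range P \<inter> range (\<lambda>v. v - P v)) = 0" unfolding dim_eq_0 .
  show ?thesis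
    using dim_sums_Int[OF linear_subspace_image[OF P subspace_UNIV] linear_subspace_image[OF R subspace_UNIV]]
    unfolding sum dim0 by simp
qed

text \<open>Idempotents of equal rank also have complementary ranges of equal dimension;
  \<open>L\<close> is glued from isomorphisms of the two pairs of ranges.\<close>

lemma conjugate_idempotents:
  fixes P C :: "'a::euclidean_space \<Rightarrow> 'a"
  assumes P: "linear P" "\<And>v. P (P v) = P v" and C: "linear C" "\<And>v. C (C v) = C v"
    and dim: "dim (range P) = dim (range C)"
  obtains L where "linear L" "inj L" "\<And>v. P (L v) = L (C v)"
proof -
  have sub: "subspace (range f)" if "linear f" for f :: "'a \<Rightarrow> 'a"
    using that linear_subspace_image subspace_UNIV by blast
  have R: "linear (\<lambda>v. v - P v)" "linear (\<lambda>v. v - C v)"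
    using P C by (auto intro: linear_compose_sub linear_ident)
  have "dim (range (\<lambda>v. v - C v)) = dim (range (\<lambda>v. v - P v))"
    using dim_idempotent[OF P] dim_idempotent[OF C] dim by simp
  then obtain L2 where L2: "linear L2" "L2 ` range (\<lambda>v. v - C v) = range (\<lambda>v. v - P v)"
    "inj_on L2 (range (\<lambda>v. v - C v))"
    using subspace_isomorphism[OF sub[OF R(2)] sub[OF R(1)]] by blast
  obtain L1 where L1: "linear L1" "L1 ` range C = range P" "inj_on L1 (range C)"
    using subspace_isomorphism[OF sub[OF C(1)] sub[OF P(1)]] dim by auto
  define L where "L v = L1 (C v) + L2 (v - C v)" for v
  have L: "linear L"
    unfolding L_def[abs_def]
    by (intro linear_compose_add linear_compose[unfolded o_def, OF _ L1(1)]
        linear_compose[unfolded o_def, OF _ L2(1)] C R)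
  have PL1: "P (L1 (C v)) = L1 (C v)" for v
  proof -
    have "L1 (C v) \<in> range P" using L1(2) by blast
    then show ?thesis using P(2) by auto
  qed
  have PL2: "P (L2 (v - C v)) = 0" for v
  proof -
    have "L2 (v - C v) \<in> range (\<lambda>v. v - P v)" using L2(2) by blast
    then show ?thesis using P by (auto simp: linear_diff)
  qed
  have PL: "P (L v) = L1 (C v)" for v by (simp add: L_def linear_add[OF P(1)] PL1 PL2)
  have "v = 0" if "L v = 0" for v
  proof -
    have "L1 (C v) = L1 (C 0)" using PL[of v] that P(1) L1(1) C(1) by (simp add: linear_0)
    from inj_onD[OF L1(3) this rangeI rangeI] have Cv: "C v = 0" using C(1) by (simp add: linear_0)
    have "L2 (v - C v) = L2 (0 - C 0)"
      using that Cv L1(1) L2(1) C(1) by (simp add: L_def linear_0)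
    from inj_onD[OF L2(3) this] have "v - C v = 0 - C 0" by blast
    then show "v = 0" using Cv C(1) by (simp add: linear_0)
  qed
  then have "inj L" using L linear_injective_0 by blast
  moreover have "P (L v) = L (C v)" for v
    using PL[of v] by (simp add: L_def C(2) linear_0[OF L2(1)])
  ultimately show ?thesis using that L by blast
qed

section \<open>Coordinate projections and the passage to slices\<close>

lemma linear_coordinate_part: "linear (coordinate_part K)"
  by (auto simp: coordinate_part_def linear_iff inner_add_left scaleR_add_left sum.distrib scaleR_sum_right)

lemma coordinate_part_Basis:
  assumes "K \<subseteq> Basis" "b \<in> Basis"
  shows "coordinate_part K b = (if b \<in> K then b else 0)"
proof -
  have "coordinate_part K b = (\<Sum>c\<in>K. if c = b then b else 0)"
    unfolding coordinate_part_def using assms by (intro sum.cong) (auto simp: inner_Basis)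
  then show ?thesis using finite_subset[OF assms(1) finite_Basis] by simp
qed

lemma coordinate_part_span:
  assumes "K \<subseteq> Basis" "v \<in> span K"
  shows "coordinate_part K v = v"
proof -
  have "coordinate_part K v = id v"
    by (rule linear_eq_on_span[OF linear_coordinate_part linear_id _ assms(2)])
      (use coordinate_part_Basis[OF assms(1)] assms(1) in auto)
  then show ?thesis by simp
qed

lemma coordinate_part_in_span: "coordinate_part K v \<in> span K"
  unfolding coordinate_part_def by (intro span_sum span_scale span_base)

lemma range_coordinate_part: "K \<subseteq> Basis \<Longrightarrow> range (coordinate_part K) = span K"
  using coordinate_part_span coordinate_part_in_span by (metis image_subsetI rangeI subsetI subset_antisym)

lemma coordinate_part_complement:
  assumes "K \<subseteq> Basis"
  shows "coordinate_part (Basis - K) v = v - coordinate_part K v"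
proof -
  have "v = coordinate_part (Basis - K) v + coordinate_part K v"
    unfolding coordinate_part_def using assms
    by (simp add: sum.subset_diff[OF assms finite_Basis, symmetric] euclidean_representation)
  then show ?thesis by (simp add: algebra_simps)
qed

lemma norm_div_one_plus_square_le: "norm ((\<rho> * inverse (1 + s \<bullet> s)) *\<^sub>R s) \<le> \<rho>"
  if "\<rho> \<ge> 0" for s :: "'a::real_inner"
proof -
  have "norm s \<le> 1 + (norm s)\<^sup>2"
    using sum_squares_bound[of 1 "norm s"] norm_ge_zero[of s] unfolding power_one mult_1_right by linarith
  then have "norm s * inverse (1 + (norm s)\<^sup>2) \<le> 1"
    by (simp add: divide_simps add_pos_nonneg flip: divide_inverse)
  then have "\<rho> * (norm s * inverse (1 + (norm s)\<^sup>2)) \<le> \<rho> * 1"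
    using that by (rule mult_left_mono)
  then show ?thesis
    using that by (simp add: dot_square_norm abs_mult algebra_simps)
qed

lemma smooth_on_slice:
  fixes f :: "'m::euclidean_space \<times> 'a::euclidean_space \<Rightarrow> 'b::real_normed_vector"
  assumes "smooth_on S f" "open T" "\<And>t. t \<in> T \<Longrightarrow> (m, t) \<in> S"
  shows "smooth_on T (\<lambda>t. f (m, t))"
  by (rule smooth_on_compose[OF assms(1) smooth_on_Pair])
    (use assms in \<open>auto intro: smooth_on_const smooth_on_bounded_linear bounded_linear_ident\<close>)

text \<open>The inverse of a fibre-preserving map preserves fibres too, so its second component at
  fixed \<open>m\<close> inverts the slice. The image of \<open>T\<close> is open because it is a
  preimage of \<open>T\<close> under that inverse.\<close>

lemma smooth_local_inverse_slices:
  fixes f :: "'m::euclidean_space \<times> 'a::euclidean_space \<Rightarrow> 'a"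
  assumes f: "smooth_on U f" and inv: "smooth_local_inverse U V (\<lambda>z. (fst z, f z)) g"
    and T: "open T" "\<And>t. t \<in> T \<Longrightarrow> (m, t) \<in> U"
  shows "diffeomorphism_onto_open_image T (\<lambda>t. f (m, t))"
proof -
  have g: "smooth_on V g" and fV: "\<And>z. z \<in> U \<Longrightarrow> (fst z, f z) \<in> V"
    and gf: "\<And>z. z \<in> U \<Longrightarrow> g (fst z, f z) = z" and fg: "\<And>y. y \<in> V \<Longrightarrow> (fst (g y), f (g y)) = y"
    using inv by (auto simp: smooth_local_inverse_def)
  have V: "open V" using g smooth_on_open by blast
  define W where "W = {q \<in> UNIV. (m, q) \<in> V}"
  have W: "open W" unfolding W_def
    by (rule open_Collect_mem_continuous_on) (auto intro!: continuous_intros V)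
  have gW: "smooth_on W (\<lambda>q. snd (g (m, q)))"
    by (rule smooth_on_linear_compose[OF bounded_linear_snd smooth_on_slice[OF g W]]) (simp add: W_def)
  have image: "(\<lambda>t. f (m, t)) ` T = {q \<in> W. snd (g (m, q)) \<in> T}"
  proof (intro equalityI subsetI)
    fix q assume "q \<in> (\<lambda>t. f (m, t)) ` T"
    then obtain t where t: "t \<in> T" "q = f (m, t)" by blast
    then show "q \<in> {q \<in> W. snd (g (m, q)) \<in> T}"
      using fV[OF T(2)] gf[OF T(2)] by (simp add: W_def)
  next
    fix q assume q: "q \<in> {q \<in> W. snd (g (m, q)) \<in> T}"
    then have "(fst (g (m, q)), f (g (m, q))) = (m, q)" using fg by (simp add: W_def)
    then have "q = f (m, snd (g (m, q)))" by (metis Pair_inject prod.collapse)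
    then show "q \<in> (\<lambda>t. f (m, t)) ` T" using q by blast
  qed
  have "open ((\<lambda>t. f (m, t)) ` T)"
    unfolding image by (rule open_Collect_mem_continuous_on[OF smooth_on_continuous_on[OF gW] W T(1)])
  then have "smooth_on ((\<lambda>t. f (m, t)) ` T) (\<lambda>q. snd (g (m, q)))"
    by (rule smooth_on_subset[OF gW]) (use image in blast)
  moreover have "smooth_on T (\<lambda>t. f (m, t))"
    by (rule smooth_on_slice[OF f T])
  ultimately show ?thesis
    unfolding diffeomorphism_onto_open_image_def using gf[OF T(2)] by auto
qed

text \<open>The bounded reparametrisation \<open>s \<mapsto> \<rho> s / (1 + |s|\<^sup>2)\<close> of the first \<open>k\<close> coordinates makes the
  residual function defined on all of \<open>\<real>\<^sup>k\<close>, so that no cut-off function is needed.\<close>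

lemma splitting_imp_obtainable:
  fixes h :: "'m::euclidean_space \<Rightarrow> 'a::euclidean_space \<Rightarrow> real"
  assumes sp: "splitting (\<lambda>z. h (fst z) (snd z)) D m0 q0 E \<theta> G g P B"
  shows "obtainable_with (dim (range P)) m0 q0 h"
proof -
  have \<theta>: "smooth_on E \<theta>" and z0: "(m0, 0) \<in> E" and \<theta>0: "\<theta> (m0, 0) = q0"
    and inj: "\<And>v. frechet_derivative \<theta> (at (m0, 0)) (0, v) = 0 \<Longrightarrow> v = 0"
    and g: "smooth_on G g"
    and G: "\<And>z. z \<in> E \<Longrightarrow> (fst z, P (snd z)) \<in> G"
    and P: "linear P" and PP: "\<And>v. P (P v) = P v"
    and B: "bilinear B" and Bsym: "\<And>v w. B v w = B w v"
    and rad: "\<And>v. P v = v \<longleftrightarrow> (\<forall>w. B v w = 0)"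
    and h_eq: "\<And>z. z \<in> E \<Longrightarrow> h (fst z) (\<theta> z) = g (fst z, P (snd z)) + B (snd z) (snd z)"
    using sp unfolding splitting_def by auto
  have zG: "(m0, 0) \<in> G" using G[OF z0] P by (simp add: linear_0)
  have "dim (range P) \<le> card (Basis :: 'a set)"
    using dim_subset_UNIV[of "range P"] by simp
  \<comment> \<open>Any coordinates in the right number will do: \<open>L\<close> carries the chosen
    ones onto the range of \<open>P\<close>.\<close>
  then obtain K :: "'a set" where K: "K \<subseteq> Basis" "card K = dim (range P)"
    using obtain_subset_with_card_n by metis
  let ?C = "coordinate_part K"
  have C: "linear ?C" "?C (?C v) = ?C v" for v
    using linear_coordinate_part coordinate_part_span[OF K(1) coordinate_part_in_span] by auto
  have "independent K" using K(1) independent_Basis independent_mono by blast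
  then have "dim (range P) = dim (range ?C)"
    using K by (simp add: range_coordinate_part dim_eq_card_independent)
  then obtain L where L: "linear L" "inj L" and PL: "\<And>v. P (L v) = L (?C v)"
    using conjugate_idempotents[OF P PP C] by blast
  obtain N0 G0 where N0: "open N0" "open G0" "(m0, 0) \<in> N0 \<times> G0" "N0 \<times> G0 \<subseteq> G"
    using open_prod_elim[OF smooth_on_open[OF g] zG] by metis
  obtain \<delta> where \<delta>: "\<delta> > 0" "ball 0 \<delta> \<subseteq> G0" using N0 open_contains_ball by (metis SigmaD2)
  obtain c where c: "c > 0" "\<And>v. norm (L v) \<le> c * norm v" using linear_bounded_pos[OF L(1)] by blast
  \<comment> \<open>Then \<open>L\<close> maps every value of \<open>\<beta>\<close>, of norm at
    most \<open>\<rho>\<close>, into the ball of radius \<open>\<delta>\<close> on which the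
    residual function is smooth.\<close>
  define \<rho> where "\<rho> = \<delta> / (2 * c)"
  have \<rho>: "\<rho> > 0" "c * \<rho> < \<delta>" using \<delta>(1) c(1) by (auto simp: \<rho>_def)
  define \<beta> where "\<beta> s = (\<rho> * inverse (1 + s \<bullet> s)) *\<^sub>R s" for s :: 'a
  have \<beta>: "smooth_on UNIV \<beta>" unfolding \<beta>_def[abs_def]
    by (intro smooth_on_scaleR smooth_on_mult smooth_on_inverse smooth_on_add smooth_on_inner
        smooth_on_const smooth_on_bounded_linear[OF bounded_linear_ident])
      (auto simp: add_pos_nonneg less_imp_neq[symmetric])
  have L\<beta>: "(m, L (\<beta> s)) \<in> G" if "m \<in> N0" for m s
  proof -
    have "norm (L (\<beta> s)) \<le> c * norm (\<beta> s)" by (rule c(2))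
    also have "\<dots> \<le> c * \<rho>"
      unfolding \<beta>_def using norm_div_one_plus_square_le[of \<rho> s] \<rho>(1) c(1) by (intro mult_left_mono) auto
    finally show ?thesis using \<rho>(2) \<delta>(2) N0(4) that by (auto simp: dist_norm subset_iff)
  qed
  define \<gamma> where "\<gamma> t = \<beta> (?C t) + (t - ?C t)" for t
  have bC: "bounded_linear ?C" "bounded_linear L" using C(1) L(1) by (auto simp: linear_conv_bounded_linear)
  have \<gamma>: "smooth_on UNIV \<gamma>" unfolding \<gamma>_def[abs_def]
    by (intro smooth_on_add smooth_on_diff smooth_on_compose[OF \<beta>] smooth_on_bounded_linear bC
        bounded_linear_ident) auto
  have C\<gamma>: "?C (\<gamma> t) = \<beta> (?C t)" for t
    using C by (simp add: \<gamma>_def \<beta>_def linear_add linear_diff linear_scale)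
  have \<gamma>0: "\<gamma> 0 = 0" using C(1) by (simp add: \<gamma>_def \<beta>_def linear_0)
  \<comment> \<open>The derivative at 0 is a nonzero multiple of the identity, so bounding the first
    coordinates does not spoil the local diffeomorphism.\<close>
  have "(\<beta> has_derivative (\<lambda>v. \<rho> *\<^sub>R v)) (at 0)"
  proof -
    have "isCont (\<lambda>s::'a. \<rho> * inverse (1 + s \<bullet> s)) 0" by (intro continuous_intros) auto
    from has_derivative_scaleR_vanishing[OF this has_derivative_ident]
    show ?thesis by (simp add: \<beta>_def[abs_def])
  qed
  then have "((\<lambda>t. \<beta> (?C t)) has_derivative (\<lambda>v. \<rho> *\<^sub>R ?C v)) (at 0)"
    using has_derivative_compose[OF bounded_linear_imp_has_derivative[OF bC(1)], of \<beta> "\<lambda>v. \<rho> *\<^sub>R v" 0 UNIV]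
      C(1) by (simp add: linear_0)
  then have D\<gamma>: "(\<gamma> has_derivative (\<lambda>v. \<rho> *\<^sub>R ?C v + (v - ?C v))) (at 0)"
    unfolding \<gamma>_def[abs_def]
    by (intro derivative_intros bounded_linear_imp_has_derivative[OF bC(1)])
  have inj\<gamma>: "v = 0" if "\<rho> *\<^sub>R ?C v + (v - ?C v) = 0" for v
  proof -
    have "?C (\<rho> *\<^sub>R ?C v + (v - ?C v)) = 0" using that C(1) by (simp add: linear_0)
    then have "?C v = 0" using C \<rho>(1) by (simp add: linear_add linear_diff linear_scale)
    then show "v = 0" using that by simp
  qed
  define s where "s z = L (\<gamma> (snd z))" for z :: "'m \<times> 'a"
  have s: "smooth_on UNIV s" unfolding s_def[abs_def]
    by (intro smooth_on_linear_compose[OF bC(2)] smooth_on_compose[OF \<gamma>]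
        smooth_on_bounded_linear[OF bounded_linear_snd]) auto
  have s0: "s (m0, 0) = 0" using L(1) by (simp add: s_def \<gamma>0 linear_0)
  define E' where "E' = {z \<in> UNIV. (fst z, s z) \<in> E}"
  have E': "open E'" unfolding E'_def
    by (rule open_Collect_mem_continuous_on[OF smooth_on_continuous_on[OF smooth_on_parameter_Pair[OF s]]])
      (use smooth_on_open[OF \<theta>] in auto)
  have z0': "(m0, 0) \<in> E'" using z0 by (simp add: E'_def s0)
  define \<theta>' where "\<theta>' z = \<theta> (fst z, s z)" for z
  have s': "smooth_on E' s" using s E' by (rule smooth_on_subset) simp
  have \<theta>': "smooth_on E' \<theta>'" unfolding \<theta>'_def[abs_def]
    by (rule smooth_on_compose[OF \<theta> smooth_on_parameter_Pair[OF s']]) (simp add: E'_def)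
  have "((\<lambda>z::'m \<times> 'a. \<gamma> (snd z)) has_derivative (\<lambda>w. \<rho> *\<^sub>R ?C (snd w) + (snd w - ?C (snd w)))) (at (m0, 0))"
    using has_derivative_compose[OF has_derivative_snd[OF has_derivative_ident], of \<gamma> _ "(m0, 0)"] D\<gamma> by simp
  from frechet_derivative_at[OF bounded_linear.has_derivative[OF bC(2) this], symmetric]
  have Ds: "frechet_derivative s (at (m0, 0)) (0, v) = L (\<rho> *\<^sub>R ?C v + (v - ?C v))" for v
    by (simp add: s_def[abs_def])
  \<comment> \<open>The first component of the map is \<open>fst\<close>, so a kernel vector lies in
    the fibre, where \<open>inj\<close> and \<open>inj\<gamma>\<close> apply.\<close>
  have inj': "w = 0" if "frechet_derivative (\<lambda>z. (fst z, \<theta>' z)) (at (m0, 0)) w = 0" for w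
  proof -
    have "((\<lambda>z. (fst z, \<theta>' z)) has_derivative (\<lambda>w. (fst w, frechet_derivative \<theta>' (at (m0, 0)) w))) (at (m0, 0))"
      using smooth_on_has_derivative[OF \<theta>' z0'] by (auto intro!: derivative_eq_intros)
    from frechet_derivative_at[OF this, symmetric] that
    have w: "fst w = 0" and D0: "frechet_derivative \<theta>' (at (m0, 0)) w = 0" by (simp_all add: zero_prod_def)
    obtain v where v: "w = (0, v)" using w by (metis prod.collapse)
    have "frechet_derivative \<theta> (at (m0, 0)) (0, L (\<rho> *\<^sub>R ?C v + (v - ?C v))) = 0"
      using D0 frechet_derivative_parameter_Pair[OF \<theta> s' z0', of w] z0 v
      by (simp add: \<theta>'_def[abs_def] s0 Ds)
    then have "L (\<rho> *\<^sub>R ?C v + (v - ?C v)) = 0" by (rule inj)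
    then have "\<rho> *\<^sub>R ?C v + (v - ?C v) = 0" using L linear_injective_0 by blast
    from inj\<gamma>[OF this] v show ?thesis by (simp add: zero_prod_def)
  qed
  obtain U V \<psi> where U: "U \<subseteq> E'" "(m0, 0) \<in> U" and inv: "smooth_local_inverse U V (\<lambda>z. (fst z, \<theta>' z)) \<psi>"
    by (rule smooth_inverse_function[OF smooth_on_parameter_Pair[OF \<theta>'] z0' inj'])
  have oU: "open U" using inv by (simp add: smooth_local_inverse_def)
  obtain N1 T where N1: "open N1" "open T" "(m0, 0) \<in> N1 \<times> T" "N1 \<times> T \<subseteq> U"
    using open_prod_elim[OF oU U(2)] by metis
  define N where "N = N1 \<inter> N0"
  have N: "open N" "m0 \<in> N" "N \<subseteq> N0" "N \<times> T \<subseteq> U" using N0 N1 by (auto simp: N_def)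
  have TU: "(\<mu>, t) \<in> U" if "\<mu> \<in> N" "t \<in> T" for \<mu> t using N(4) that by blast
  have \<theta>U: "smooth_on U \<theta>'" by (rule smooth_on_subset[OF \<theta>' oU U(1)])
  let ?Q = "\<lambda>v. B (L v) (L v)"
  have eq: "h \<mu> (\<theta>' (\<mu>, t)) = g (\<mu>, L (\<beta> (?C t))) + ?Q (coordinate_part (Basis - K) t)"
    if "\<mu> \<in> N" "t \<in> T" for \<mu> t
  proof -
    have "(\<mu>, s (\<mu>, t)) \<in> E" using TU[OF that] U(1) by (auto simp: E'_def)
    from h_eq[OF this] have *: "h \<mu> (\<theta>' (\<mu>, t)) = g (\<mu>, L (\<beta> (?C t))) + B (L (\<gamma> t)) (L (\<gamma> t))"
      by (simp add: \<theta>'_def s_def PL C\<gamma>)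
    \<comment> \<open>The first coordinates land in the radical of \<open>B\<close>, so only the
      complementary coordinates enter the quadratic form.\<close>
    have "P (L (\<beta> (?C t))) = L (\<beta> (?C t))"
      using PL[of "\<gamma> t"] PP[of "L (\<gamma> t)"] by (simp add: C\<gamma>)
    then have "B (L (\<beta> (?C t))) w = 0" "B w (L (\<beta> (?C t))) = 0" for w
      using rad Bsym by metis+
    then have "B (L (\<gamma> t)) (L (\<gamma> t)) = ?Q (t - ?C t)"
      using B L(1) by (simp add: \<gamma>_def linear_add bilinear_ladd bilinear_radd)
    then show ?thesis unfolding * coordinate_part_complement[OF K(1)] by simp
  qed
  have bilBL: "bilinear (\<lambda>v w. B (L v) (L w))"
    using B L(1) unfolding bilinear_def linear_iff by simp
  have nondeg: "v = 0"
    if v: "v \<in> span (Basis - K)" and 0: "\<And>w. w \<in> span (Basis - K) \<Longrightarrow> B (L v) (L w) = 0" for v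
  proof -
    have "B (L v) x = 0" for x
    proof -
      \<comment> \<open>The part \<open>?C w\<close> is sent into the radical and
        \<open>w - ?C w\<close> lies in the span tested by the assumption. Hence \<open>L v\<close>
        is in the radical, so \<open>v\<close> is fixed by \<open>?C\<close> as well as by the
        complementary projection.\<close>
      obtain w where w: "x = L w" using linear_injective_imp_surjective[OF L] by auto
      have "P (L (?C w)) = L (?C w)" using PL[of "?C w"] by (simp add: C(2))
      then have "B (L v) (L (?C w)) = 0" using rad Bsym by metis
      moreover have "B (L v) (L (w - ?C w)) = 0"
        using 0[OF coordinate_part_in_span] coordinate_part_complement[OF K(1)] by simp
      ultimately show ?thesis using B L(1) by (simp add: w linear_diff bilinear_rsub)
    qed
    then have "L (?C v) = L v" using rad PL by metis
    then have "?C v = v" using L(2) by (simp add: inj_eq)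
    moreover have "coordinate_part (Basis - K) v = v" by (rule coordinate_part_span[OF _ v]) auto
    ultimately show ?thesis using coordinate_part_complement[OF K(1), of v] by simp
  qed
  show ?thesis
    unfolding obtainable_with_def
  proof (intro exI conjI ballI)
    show "K \<subseteq> Basis" "card K = dim (range P)" by fact+
    show "open N" "m0 \<in> N" "open T" by fact+
    show "0 \<in> T" using N1(3) by simp
    have NT: "open (N \<times> T)" using N(1) N1(2) by (rule open_Times)
    show "smooth_family_on N T (\<lambda>\<mu> t. \<theta>' (\<mu>, t))"
      using smooth_on_subset[OF \<theta>U NT N(4)] by (simp add: smooth_family_on_def)
    show "diffeomorphism_onto_open_image T ((\<lambda>\<mu> t. \<theta>' (\<mu>, t)) \<mu>)" if "\<mu> \<in> N" for \<mu>
      using smooth_local_inverse_slices[OF \<theta>U inv N1(2) TU[OF that]] by simp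
    show "\<theta>' (m0, 0) = q0" by (simp add: \<theta>'_def s0 \<theta>0)
    have NU: "open (N \<times> (UNIV :: 'a set))" using N(1) by (simp add: open_Times)
    have "smooth_on (N \<times> UNIV) (\<lambda>z. g (fst z, L (\<beta> (snd z))))"
      by (intro smooth_on_compose[OF g] smooth_on_parameter_Pair smooth_on_linear_compose[OF bC(2)]
          smooth_on_compose[OF \<beta>] smooth_on_bounded_linear[OF bounded_linear_snd] NU)
        (use L\<beta> N(3) in auto)
    then show "smooth_family_on N UNIV (\<lambda>\<mu> s. g (\<mu>, L (\<beta> s)))"
      by (simp add: smooth_family_on_def case_prod_unfold)
    show "nondegenerate_quadratic_form_on (span (Basis - K)) ?Q"
      unfolding nondegenerate_quadratic_form_on_def
      using bilBL Bsym nondeg by (intro exI[of _ "\<lambda>v w. B (L v) (L w)"]) auto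
    \<comment> \<open>The zero function suffices: the critical values along the parameter are
      contained in the residual family.\<close>
    show "smooth_on N (\<lambda>\<mu>. 0 :: real)" by (rule smooth_on_const[OF N(1)])
    show "h \<mu> (\<theta>' (\<mu>, t)) = g (\<mu>, L (\<beta> (?C t))) + ?Q (coordinate_part (Basis - K) t) + 0"
      if "\<mu> \<in> N" "t \<in> T" for \<mu> t using eq[OF that] by simp
  qed
qed

section \<open>The parametric splitting lemma\<close>

lemma frechet_derivative_cong_open:
  assumes "open S" "x \<in> S" "\<And>y. y \<in> S \<Longrightarrow> f y = g y" "(f has_derivative f') (at x)"
  shows "frechet_derivative g (at x) = f'"
  using has_derivative_transform_within_open[OF assms(4,1,2,3)] frechet_derivative_at by metis

lemma second_derivative_slot_expand:
  fixes h :: "'m::euclidean_space \<times> 'a::euclidean_space \<Rightarrow> real"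
  assumes h: "smooth_on D h" and z: "z \<in> D"
  shows "frechet_derivative (\<lambda>y. frechet_derivative h (at y) (0, c)) (at z) x =
    (\<Sum>b\<in>Basis. (c \<bullet> b) * frechet_derivative (\<lambda>y. frechet_derivative h (at y) (0, b)) (at z) x)"
proof -
  have der: "((\<lambda>y. \<Sum>b\<in>Basis. (c \<bullet> b) * frechet_derivative h (at y) (0, b)) has_derivative
     (\<lambda>x. \<Sum>b\<in>Basis. (c \<bullet> b) * frechet_derivative (\<lambda>y. frechet_derivative h (at y) (0, b)) (at z) x)) (at z)"
    by (intro has_derivative_sum has_derivative_mult_right
        smooth_on_has_derivative[OF smooth_on_frechet_derivative[OF h] z])
  have eq: "(\<Sum>b\<in>Basis. (c \<bullet> b) * frechet_derivative h (at y) (0, b)) = frechet_derivative h (at y) (0, c)"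
    if "y \<in> D" for y
  proof -
    have "linear (\<lambda>v. frechet_derivative h (at y) (0, v))"
      by (rule linear_compose[unfolded o_def, OF _ smooth_on_linear_frechet_derivative[OF h that]])
        (simp add: linear_iff)
    from linear_euclidean_representation[OF this, of c] show ?thesis by simp
  qed
  have "frechet_derivative (\<lambda>y. frechet_derivative h (at y) (0, c)) (at z) = (\<lambda>x. \<Sum>b\<in>Basis.
      (c \<bullet> b) * frechet_derivative (\<lambda>y. frechet_derivative h (at y) (0, b)) (at z) x)"
    by (rule frechet_derivative_cong_open[OF smooth_on_open[OF h] z eq der])
  then show ?thesis by simp
qed

text \<open>The second derivative of \<open>\<theta>\<close> enters multiplied by the fibre
  derivative of \<open>h\<close>, which vanishes at this point. The product rule with a vanishing
  factor removes it without ever computing it.\<close>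

lemma second_derivative_at_critical_point:
  fixes h :: "'m::euclidean_space \<times> 'a::euclidean_space \<Rightarrow> real"
  assumes h: "smooth_on D h" and \<theta>: "smooth_on E \<theta>" and z: "z \<in> E"
    and D: "\<And>z. z \<in> E \<Longrightarrow> (fst z, \<theta> z) \<in> D"
    and crit: "\<And>v. frechet_derivative h (at (fst z, \<theta> z)) (0, v) = 0"
  shows "frechet_derivative (\<lambda>z. frechet_derivative (\<lambda>z. h (fst z, \<theta> z)) (at z) (0, u)) (at z) (0, v)
    = frechet_derivative (\<lambda>y. frechet_derivative h (at y) (0, frechet_derivative \<theta> (at z) (0, u)))
        (at (fst z, \<theta> z)) (0, frechet_derivative \<theta> (at z) (0, v))"
proof -
  let ?\<psi> = "\<lambda>z. frechet_derivative \<theta> (at z) (0, u)"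
  let ?H = "\<lambda>b y. frechet_derivative h (at y) (0, b)"
  let ?\<Theta> = "\<lambda>z. (fst z, \<theta> z)"
  have H: "smooth_on D (?H b)" for b by (rule smooth_on_frechet_derivative[OF h])
  have \<psi>: "isCont (\<lambda>z. ?\<psi> z \<bullet> b) z" for b
    using smooth_on_continuous_on[OF smooth_on_frechet_derivative[OF \<theta>]] smooth_on_open[OF \<theta>] z
    by (auto simp: continuous_on_eq_continuous_at intro: continuous_intros)
  have "(?\<Theta> has_derivative (\<lambda>w. (fst w, frechet_derivative \<theta> (at z) w))) (at z)"
    using smooth_on_has_derivative[OF \<theta> z] by (auto intro!: derivative_eq_intros)
  from has_derivative_compose[OF this smooth_on_has_derivative[OF H D[OF z]]]
  have "((\<lambda>z. ?H b (?\<Theta> z)) has_derivative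
      (\<lambda>w. frechet_derivative (?H b) (at (?\<Theta> z)) (fst w, frechet_derivative \<theta> (at z) w))) (at z)" for b .
  from has_derivative_scaleR_vanishing[OF \<psi> this crit]
  have "((\<lambda>z. \<Sum>b\<in>Basis. (?\<psi> z \<bullet> b) *\<^sub>R ?H b (?\<Theta> z)) has_derivative
      (\<lambda>w. \<Sum>b\<in>Basis. (?\<psi> z \<bullet> b) *\<^sub>R
        frechet_derivative (?H b) (at (?\<Theta> z)) (fst w, frechet_derivative \<theta> (at z) w))) (at z)"
    by (intro has_derivative_sum)
  then have "frechet_derivative (\<lambda>z. frechet_derivative (\<lambda>z. h (?\<Theta> z)) (at z) (0, u)) (at z) =
      (\<lambda>w. \<Sum>b\<in>Basis. (?\<psi> z \<bullet> b) *\<^sub>R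
        frechet_derivative (?H b) (at (?\<Theta> z)) (fst w, frechet_derivative \<theta> (at z) w))"
  proof (rule frechet_derivative_cong_open[OF smooth_on_open[OF \<theta>] z, rotated])
    fix y assume y: "y \<in> E"
    have "linear (\<lambda>v. frechet_derivative h (at (?\<Theta> y)) (0, v))"
      by (rule linear_compose[unfolded o_def, OF _ smooth_on_linear_frechet_derivative[OF h D[OF y]]])
        (simp add: linear_iff)
    from linear_euclidean_representation[OF this, of "?\<psi> y"]
    show "(\<Sum>b\<in>Basis. (?\<psi> y \<bullet> b) *\<^sub>R ?H b (?\<Theta> y)) = frechet_derivative (\<lambda>z. h (?\<Theta> z)) (at y) (0, u)"
      using frechet_derivative_parameter_Pair[OF h \<theta> y D[OF y]] by simp
  qed
  then show ?thesis
    using second_derivative_slot_expand[OF h D[OF z], of "?\<psi> z"] by simp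
qed

text \<open>Both directions are in the fibre because the corank concerns the single germ at fixed
  parameter, not its unfolding.\<close>

definition fibre_hessian_kernel ::
  "('m::euclidean_space \<times> 'a::euclidean_space \<Rightarrow> real) \<Rightarrow> 'm \<times> 'a \<Rightarrow> 'a set" where
  "fibre_hessian_kernel h z =
     {u. \<forall>w. frechet_derivative (\<lambda>y. frechet_derivative h (at y) (0, w)) (at z) (0, u) = 0}"

lemma subspace_fibre_hessian_kernel:
  assumes "smooth_on D h" "z \<in> D"
  shows "subspace (fibre_hessian_kernel h z)"
proof -
  have lin: "linear (\<lambda>u. frechet_derivative (\<lambda>y. frechet_derivative h (at y) (0, w)) (at z) (0, u))" for w
    by (rule linear_compose[unfolded o_def, OF _ smooth_on_linear_frechet_derivative[OF
            smooth_on_frechet_derivative[OF assms(1)] assms(2)]])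
      (simp add: linear_iff)
  show ?thesis
    unfolding subspace_def fibre_hessian_kernel_def
    using linear_0[OF lin] linear_add[OF lin] linear_scale[OF lin] by simp
qed

text \<open>The derivative \<open>L\<close> of \<open>\<theta>\<close> in the fibre is injective and
  maps the range of \<open>P\<close> into the kernel. For \<open>u\<close> fixed by \<open>P\<close>
  the form \<open>B\<close> drops out of the derivative along \<open>u\<close>, and the Hessian of
  the transformed function reduces to \<open>A u (P v)\<close>, which is zero.\<close>

lemma dim_complete_splitting:
  fixes h :: "'m::euclidean_space \<times> 'a::euclidean_space \<Rightarrow> real"
  assumes h: "smooth_on D h" and crit: "\<And>v. frechet_derivative h (at (m0, q0)) (0, v) = 0"
    and sp: "splitting h D m0 q0 E \<theta> G g P B"
    and degen: "\<And>e. P e = e \<Longrightarrow>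
      frechet_derivative (\<lambda>z. frechet_derivative g (at z) (0, e)) (at (m0, 0)) (0, e) = 0"
  shows "dim (range P) \<le> dim (fibre_hessian_kernel h (m0, q0))"
proof -
  have \<theta>: "smooth_on E \<theta>" and z0: "(m0, 0) \<in> E" and \<theta>0: "\<theta> (m0, 0) = q0"
    and D: "\<And>z. z \<in> E \<Longrightarrow> (fst z, \<theta> z) \<in> D"
    and inj: "\<And>v. frechet_derivative \<theta> (at (m0, 0)) (0, v) = 0 \<Longrightarrow> v = 0"
    and g: "smooth_on G g"
    and G: "\<And>z. z \<in> E \<Longrightarrow> (fst z, P (snd z)) \<in> G"
    and P: "linear P" and PP: "\<And>v. P (P v) = P v"
    and B: "bilinear B" and Bsym: "\<And>v w. B v w = B w v"
    and rad: "\<And>v. P v = v \<longleftrightarrow> (\<forall>w. B v w = 0)"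
    and h_eq: "\<And>z. z \<in> E \<Longrightarrow> h (fst z, \<theta> z) = g (fst z, P (snd z)) + B (snd z) (snd z)"
    using sp unfolding splitting_def by blast+
  have zG: "(m0, 0) \<in> G" using G[OF z0] P by (simp add: linear_0)
  have zD: "(m0, q0) \<in> D" using D[OF z0] \<theta>0 by simp
  define A where "A u v = frechet_derivative (\<lambda>z. frechet_derivative g (at z) (0, u)) (at (m0, 0)) (0, v)" for u v
  have Asym: "A u v = A v u" for u v
    unfolding A_def by (rule smooth_on_second_derivative_commute[OF g zG])
  have Aadd: "A u (v + w) = A u v + A u w" for u v w
    using linear_add[OF smooth_on_linear_frechet_derivative[OF smooth_on_frechet_derivative[OF g] zG],
        of "(0, u)" "(0, v)" "(0, w)"] by (simp add: A_def)
  \<comment> \<open>Polarisation extends the vanishing from the diagonal to all pairs in the range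
    of \<open>P\<close>.\<close>
  have A0: "A u v = 0" if u: "P u = u" and v: "P v = v" for u v
  proof -
    have "A (u + v) (u + v) = A u u + A u v + (A v u + A v v)"
      by (simp add: Aadd Asym[of "u + v"])
    moreover have "A (u + v) (u + v) = 0" "A u u = 0" "A v v = 0"
      using degen u v linear_add[OF P, of u v] by (simp_all add: A_def)
    ultimately show ?thesis using Asym[of u v] by simp
  qed
  define k where "k z = h (fst z, \<theta> z)" for z
  let ?\<pi> = "\<lambda>z::'m \<times> 'a. (fst z, P (snd z))"
  have bP: "bounded_linear (\<lambda>z::'m \<times> 'a. P (snd z))" by (rule bounded_linear_on_snd[OF P])
  have E: "open E" by (rule smooth_on_open[OF \<theta>])
  have sP: "smooth_on E (\<lambda>z. P (snd z))" by (rule smooth_on_bounded_linear[OF bP E])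
  have DP: "frechet_derivative (\<lambda>z::'m \<times> 'a. P (snd z)) (at z) = (\<lambda>w. P (snd w))" for z
    using frechet_derivative_at[OF bounded_linear_imp_has_derivative[OF bP]] by simp
  have bB: "bounded_bilinear B" using B by (simp add: bilinear_conv_bounded_bilinear)
  have Dk: "frechet_derivative k (at z) (0, u) = frechet_derivative g (at (?\<pi> z)) (0, u)"
    if z: "z \<in> E" and u: "P u = u" for z u
  proof -
    have g\<pi>: "smooth_on E (\<lambda>z. g (?\<pi> z))"
      by (rule smooth_on_compose[OF g smooth_on_parameter_Pair[OF sP]]) (rule G)
    have "((\<lambda>z. g (?\<pi> z) + B (snd z) (snd z)) has_derivative
        (\<lambda>w. frechet_derivative (\<lambda>z. g (?\<pi> z)) (at z) w + (B (snd z) (snd w) + B (snd w) (snd z)))) (at z)"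
      by (intro has_derivative_add smooth_on_has_derivative[OF g\<pi> z] bounded_bilinear.FDERIV[OF bB]
          has_derivative_snd has_derivative_ident)
    from frechet_derivative_cong_open[OF E z _ this, of k]
    have "frechet_derivative k (at z) (0, u)
        = frechet_derivative (\<lambda>z. g (?\<pi> z)) (at z) (0, u) + (B (snd z) u + B u (snd z))"
      using h_eq by (simp add: k_def)
    moreover have "B u (snd z) = 0" "B (snd z) u = 0" using rad u Bsym by metis+
    ultimately show ?thesis
      using frechet_derivative_parameter_Pair[OF g sP z G[OF z]] u by (simp add: DP)
  qed
  have Kk: "frechet_derivative (\<lambda>z. frechet_derivative k (at z) (0, u)) (at (m0, 0)) (0, v) = 0"
    if u: "P u = u" for u v
  proof -
    let ?gu = "\<lambda>z. frechet_derivative g (at z) (0, u)"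
    have gu: "smooth_on G ?gu" by (rule smooth_on_frechet_derivative[OF g])
    have "smooth_on E (\<lambda>z. ?gu (?\<pi> z))"
      by (rule smooth_on_compose[OF gu smooth_on_parameter_Pair[OF sP]]) (rule G)
    from frechet_derivative_cong_open[OF E z0 _ smooth_on_has_derivative[OF this z0],
        of "\<lambda>z. frechet_derivative k (at z) (0, u)"]
    have "frechet_derivative (\<lambda>z. frechet_derivative k (at z) (0, u)) (at (m0, 0)) (0, v)
        = frechet_derivative (\<lambda>z. ?gu (?\<pi> z)) (at (m0, 0)) (0, v)"
      using Dk[OF _ u] by simp
    also have "\<dots> = A u (P v)"
      using frechet_derivative_parameter_Pair[OF gu sP z0 G[OF z0], of "(0, v)"] P
      by (simp add: DP A_def linear_0)
    also have "\<dots> = 0" by (rule A0[OF u PP])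
    finally show ?thesis .
  qed
  define L where "L v = frechet_derivative \<theta> (at (m0, 0)) (0, v)" for v
  have L: "linear L" unfolding L_def[abs_def]
    by (rule linear_compose[unfolded o_def, OF _ smooth_on_linear_frechet_derivative[OF \<theta> z0]])
      (simp add: linear_iff)
  have "inj L" using inj linear_injective_0[OF L] by (simp add: L_def)
  have "L u \<in> fibre_hessian_kernel h (m0, q0)" if u: "P u = u" for u
  proof -
    let ?H = "\<lambda>w x. frechet_derivative (\<lambda>y. frechet_derivative h (at y) (0, w)) (at (m0, q0)) (0, x)"
    have "?H w (L u) = 0" for w
    proof -
      \<comment> \<open>Testing against vectors \<open>L v\<close> is enough, as an injective
        endomorphism in finite dimension is onto.\<close>
      obtain v where v: "w = L v"
        using linear_injective_imp_surjective[OF L \<open>inj L\<close>] by auto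
      have "?H (L u) (L v) = 0"
        using second_derivative_at_critical_point[OF h \<theta> z0 D, of u v] crit Kk[OF u, of v]
        by (simp add: \<theta>0 L_def k_def[abs_def])
      then show ?thesis
        unfolding v using smooth_on_second_derivative_commute[OF h zD] by metis
    qed
    then show ?thesis by (simp add: fibre_hessian_kernel_def)
  qed
  then have "L ` range P \<subseteq> fibre_hessian_kernel h (m0, q0)"
    using PP by auto
  then have "dim (L ` range P) \<le> dim (fibre_hessian_kernel h (m0, q0))"
    by (rule dim_subset)
  moreover have "dim (L ` range P) = dim (range P)"
    using dim_image_eq[OF L] inj_on_subset[OF \<open>inj L\<close>] by blast
  ultimately show ?thesis by simp
qed

theorem parametric_splitting_lemma:
  fixes h :: "'m::euclidean_space \<Rightarrow> 'a::euclidean_space \<Rightarrow> real"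
  assumes "smooth_on D (\<lambda>z. h (fst z) (snd z))" "(m0, q0) \<in> D"
    and "\<And>v. frechet_derivative (\<lambda>z. h (fst z) (snd z)) (at (m0, q0)) (0, v) = 0"
  shows "\<exists>k \<le> dim (fibre_hessian_kernel (\<lambda>z. h (fst z) (snd z)) (m0, q0)). obtainable_with k m0 q0 h"
proof -
  obtain E \<theta> G g P B where sp: "splitting (\<lambda>z. h (fst z) (snd z)) D m0 q0 E \<theta> G g P B"
    and degen: "\<And>e. P e = e \<Longrightarrow>
      frechet_derivative (\<lambda>z. frechet_derivative g (at z) (0, e)) (at (m0, 0)) (0, e) = 0"
    by (rule complete_splitting[OF assms]) blast
  show ?thesis
    using dim_complete_splitting[OF assms(1,3) sp degen] splitting_imp_obtainable[OF sp] by blast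
qed

section \<open>The Dirichlet problem\<close>

lemma frechet_derivative_slice:
  fixes h :: "'m::euclidean_space \<times> 'a::euclidean_space \<Rightarrow> 'b::real_normed_vector"
  assumes "smooth_on S h" "(m, q) \<in> S"
  shows "frechet_derivative (\<lambda>q. h (m, q)) (at q) v = frechet_derivative h (at (m, q)) (0, v)"
proof -
  have "((\<lambda>q. (m, q)) has_derivative (\<lambda>v. (0, v))) (at q)"
    by (auto intro!: derivative_eq_intros)
  from has_derivative_compose[OF this smooth_on_has_derivative[OF assms]]
  show ?thesis by (simp flip: frechet_derivative_at)
qed

text \<open>A function in place of the relation \<open>GDERIV\<close>, so that the graph of an exact
  1-form can be parametrised and differentiated.\<close>

definition gradient :: "('a::euclidean_space \<Rightarrow> real) \<Rightarrow> 'a \<Rightarrow> 'a" where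
  "gradient f q = (\<Sum>b\<in>Basis. frechet_derivative f (at q) b *\<^sub>R b)"

lemma has_derivative_gradient:
  assumes "smooth_on U f" "q \<in> U"
  shows "(gradient f has_derivative
    (\<lambda>u. \<Sum>b\<in>Basis. frechet_derivative (\<lambda>q. frechet_derivative f (at q) b) (at q) u *\<^sub>R b)) (at q)"
  unfolding gradient_def[abs_def]
  by (intro has_derivative_sum has_derivative_scaleR_left
      smooth_on_has_derivative[OF smooth_on_frechet_derivative[OF assms(1)] assms(2)])

lemma exact_form_image_eq:
  assumes f: "smooth_on U f"
  shows "exact_form_image f U = (\<lambda>q. (q, gradient f q)) ` U"
proof -
  have "GDERIV f q :> p \<longleftrightarrow> p = gradient f q" if q: "q \<in> U" for q p
  proof -
    have f': "(f has_derivative frechet_derivative f (at q)) (at q)"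
      by (rule smooth_on_has_derivative[OF f q])
    have "frechet_derivative f (at q) = (\<lambda>v. v \<bullet> gradient f q)"
    proof
      fix v
      show "frechet_derivative f (at q) v = v \<bullet> gradient f q"
        using linear_euclidean_representation[OF smooth_on_linear_frechet_derivative[OF f q], of v]
        by (simp add: gradient_def inner_sum_right mult.commute)
    qed
    with f' have g: "(f has_derivative (\<lambda>v. v \<bullet> gradient f q)) (at q)" by simp
    show ?thesis
    proof
      assume "GDERIV f q :> p"
      then have "(f has_derivative (\<lambda>v. v \<bullet> p)) (at q)" by (simp add: gderiv_def)
      then have "(\<lambda>v. v \<bullet> p) = (\<lambda>v. v \<bullet> gradient f q)" using g has_derivative_unique by blast
      then have "(p - gradient f q) \<bullet> p = (p - gradient f q) \<bullet> gradient f q" by meson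
      then have "(p - gradient f q) \<bullet> (p - gradient f q) = 0" by (simp add: inner_diff_right)
      then show "p = gradient f q" by simp
    qed (use g in \<open>simp add: gderiv_def\<close>)
  qed
  then show ?thesis by (auto simp: exact_form_image_def)
qed

text \<open>An equation between coordinates, unlike a parametrised image, can be differentiated
  along any map into the set.\<close>

lemma \<Gamma>_iff: "z \<in> \<Gamma> \<phi> \<longleftrightarrow> \<phi> (fst (fst z), fst (snd z)) = (snd (snd z), snd (fst z))"
proof -
  obtain a b c d where z: "z = ((a, b), (c, d))" by (metis surj_pair)
  show ?thesis unfolding \<Gamma>_def z
    by (auto simp: image_iff)
qed

text \<open>On \<open>K\<close> the Hessians of \<open>f\<close> and \<open>g\<close> agree, so
  \<open>(u, S f u)\<close> is tangent to both graphs. Pulled back by the inverse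
  \<open>\<Phi>\<close> of \<open>\<Psi>\<close>, it is determined by its
  \<open>y\<close>-component, which gives an injective linear map from \<open>K\<close> into a space
  of dimension \<open>n\<close>.\<close>

lemma dim_common_tangent_space:
  fixes \<phi> :: "'b::euclidean_space \<times> 'b \<Rightarrow> 'b \<times> 'b" and f g :: "'b \<times> 'b \<Rightarrow> real"
  assumes \<phi>: "smooth_on UNIV \<phi>"
    and diffeo: "diffeomorphism_onto_open_image W \<Psi>" and zW: "zs \<in> W" and zs_fixed: "\<Psi> zs = zs"
    and z\<Gamma>: "zs \<in> \<Gamma> \<phi>" and zD: "zs \<in> Dirichlet xs Xs"
    and f: "smooth_on U f" and g: "smooth_on U g"
    and imf: "\<Psi> ` (\<Gamma> \<phi> \<inter> W) = exact_form_image f U"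
    and img: "\<Psi> ` (Dirichlet xs Xs \<inter> W) = exact_form_image g U"
    and K: "subspace K"
    and tangent: "\<And>u w. u \<in> K \<Longrightarrow> frechet_derivative (\<lambda>q. frechet_derivative f (at q) w) (at (fst zs)) u
      = frechet_derivative (\<lambda>q. frechet_derivative g (at q) w) (at (fst zs)) u"
  shows "dim K \<le> DIM('b)"
proof -
  let ?q = "fst zs"
  obtain \<Phi> where \<Phi>: "smooth_on (\<Psi> ` W) \<Phi>" and \<Phi>\<Psi>: "\<And>z. z \<in> W \<Longrightarrow> \<Phi> (\<Psi> z) = z"
    and \<Psi>: "smooth_on W \<Psi>"
    using diffeo by (auto simp: diffeomorphism_onto_open_image_def)
  have zI: "zs \<in> \<Psi> ` W" using zW zs_fixed by (metis imageI)
  let ?\<Phi>' = "frechet_derivative \<Phi> (at zs)"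
  have lin\<Phi>: "linear ?\<Phi>'" by (rule smooth_on_linear_frechet_derivative[OF \<Phi> zI])
  have inj\<Phi>: "\<zeta> = 0" if "?\<Phi>' \<zeta> = 0" for \<zeta>
  proof -
    have "((\<lambda>z. \<Phi> (\<Psi> z)) has_derivative (\<lambda>v. ?\<Phi>' (frechet_derivative \<Psi> (at zs) v))) (at zs)"
      using has_derivative_compose[OF smooth_on_has_derivative[OF \<Psi> zW], of \<Phi> ?\<Phi>']
        smooth_on_has_derivative[OF \<Phi> zI] by (simp add: zs_fixed)
    then have "((\<lambda>z. z) has_derivative (\<lambda>v. ?\<Phi>' (frechet_derivative \<Psi> (at zs) v))) (at zs)"
      by (rule has_derivative_transform_within_open[OF _ smooth_on_open[OF \<Psi>] zW \<Phi>\<Psi>])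
    then have id: "(\<lambda>v. ?\<Phi>' (frechet_derivative \<Psi> (at zs) v)) = (\<lambda>v. v)"
      using has_derivative_unique has_derivative_ident by blast
    \<comment> \<open>A right inverse gives surjectivity, and an endomorphism in finite dimension is
      then injective.\<close>
    then have "surj ?\<Phi>'" by (metis surjI)
    then have "inj ?\<Phi>'" using lin\<Phi> linear_surjective_imp_injective by blast
    then show "\<zeta> = 0" using that lin\<Phi> linear_injective_0 by blast
  qed
  define S where "S k u = (\<Sum>b\<in>Basis. frechet_derivative (\<lambda>q. frechet_derivative k (at q) b) (at ?q) u *\<^sub>R b)"
    for k :: "'b \<times> 'b \<Rightarrow> real" and u
  have graph: "?q \<in> U" "((\<lambda>q. \<Phi> (q, gradient k q)) has_derivative (\<lambda>u. ?\<Phi>' (u, S k u))) (at ?q)"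
    "\<And>q. q \<in> U \<Longrightarrow> \<Phi> (q, gradient k q) \<in> L" "\<Phi> (?q, gradient k ?q) = zs"
    if k: "smooth_on U k" and L: "\<Psi> ` (L \<inter> W) = exact_form_image k U" "zs \<in> L" for k L
  proof -
    have "zs \<in> exact_form_image k U" using L zW zs_fixed by (metis IntI imageI)
    then have z: "?q \<in> U" "zs = (?q, gradient k ?q)"
      unfolding exact_form_image_eq[OF k] by auto
    then show "?q \<in> U" by simp
    show "\<Phi> (?q, gradient k ?q) = zs" using z(2) \<Phi>\<Psi>[OF zW] zs_fixed by simp
    have "((\<lambda>q. (q, gradient k q)) has_derivative (\<lambda>u. (u, S k u))) (at ?q)"
      unfolding S_def using has_derivative_gradient[OF k z(1)] by (intro derivative_intros)
    from has_derivative_compose[OF this, of \<Phi> ?\<Phi>']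
    show "((\<lambda>q. \<Phi> (q, gradient k q)) has_derivative (\<lambda>u. ?\<Phi>' (u, S k u))) (at ?q)"
      using smooth_on_has_derivative[OF \<Phi> zI] by (simp flip: z(2))
    fix q assume "q \<in> U"
    then have "(q, gradient k q) \<in> \<Psi> ` (L \<inter> W)" unfolding L(1) exact_form_image_eq[OF k] by blast
    then show "\<Phi> (q, gradient k q) \<in> L" using \<Phi>\<Psi> by auto
  qed
  note gf = graph[OF f imf z\<Gamma>] and gg = graph[OF g img zD]
  have U: "open U" using f smooth_on_open by blast
  \<comment> \<open>Points of \<Gamma> have coordinates \<open>((x, Y), (y, X))\<close>; the
    equation \<open>\<phi> (x, y) = (X, Y)\<close> is differentiated along the pulled-back graph of
    \<open>df\<close>.\<close>
  have \<Gamma>_tangent: "frechet_derivative \<phi> (at (fst (fst zs), fst (snd zs))) (fst (fst \<eta>), fst (snd \<eta>))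
      = (snd (snd \<eta>), snd (fst \<eta>))" if "\<eta> = ?\<Phi>' (u, S f u)" for u \<eta>
  proof -
    let ?y = "\<lambda>q. \<Phi> (q, gradient f q)" and ?y' = "\<lambda>u. ?\<Phi>' (u, S f u)"
    let ?\<phi>' = "frechet_derivative \<phi> (at (fst (fst zs), fst (snd zs)))"
    have "((\<lambda>q. (fst (fst (?y q)), fst (snd (?y q)))) has_derivative
        (\<lambda>u. (fst (fst (?y' u)), fst (snd (?y' u))))) (at ?q)"
      by (intro derivative_intros gf(2))
    from has_derivative_compose[OF this, of \<phi> ?\<phi>']
    have "((\<lambda>q. \<phi> (fst (fst (?y q)), fst (snd (?y q)))) has_derivative
        (\<lambda>u. ?\<phi>' (fst (fst (?y' u)), fst (snd (?y' u))))) (at ?q)"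
      using smooth_on_has_derivative[OF \<phi>] by (simp add: gf(4))
    then have "((\<lambda>q. (snd (snd (?y q)), snd (fst (?y q)))) has_derivative
        (\<lambda>u. ?\<phi>' (fst (fst (?y' u)), fst (snd (?y' u))))) (at ?q)"
      by (rule has_derivative_transform_within_open[OF _ U gf(1)])
        (use gf(3) in \<open>simp add: \<Gamma>_iff\<close>)
    moreover have "((\<lambda>q. (snd (snd (?y q)), snd (fst (?y q)))) has_derivative
        (\<lambda>u. (snd (snd (?y' u)), snd (fst (?y' u))))) (at ?q)"
      by (intro derivative_intros gf(2))
    ultimately have "(\<lambda>u. ?\<phi>' (fst (fst (?y' u)), fst (snd (?y' u))))
        = (\<lambda>u. (snd (snd (?y' u)), snd (fst (?y' u))))"
      by (rule has_derivative_unique)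
    then show ?thesis unfolding that by meson
  qed
  have Dirichlet_tangent: "fst (fst \<eta>) = 0 \<and> snd (snd \<eta>) = 0" if "\<eta> = ?\<Phi>' (u, S g u)" for u \<eta>
  proof -
    let ?y = "\<lambda>q. \<Phi> (q, gradient g q)" and ?y' = "\<lambda>u. ?\<Phi>' (u, S g u)"
    have "((\<lambda>q. (fst (fst (?y q)), snd (snd (?y q)))) has_derivative
        (\<lambda>u. (fst (fst (?y' u)), snd (snd (?y' u))))) (at ?q)"
      by (intro derivative_intros gg(2))
    then have "((\<lambda>q. (xs, Xs)) has_derivative (\<lambda>u. (fst (fst (?y' u)), snd (snd (?y' u))))) (at ?q)"
      by (rule has_derivative_transform_within_open[OF _ U gg(1)])
        (use gg(3) in \<open>fastforce simp: Dirichlet_def\<close>)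
    then have "(\<lambda>u. (fst (fst (?y' u)), snd (snd (?y' u)))) = (\<lambda>u. 0)"
      using has_derivative_const by (rule has_derivative_unique)
    then have "(fst (fst (?y' u)), snd (snd (?y' u))) = 0" by meson
    then show ?thesis unfolding that by (simp add: zero_prod_def)
  qed
  define R where "R u = fst (snd (?\<Phi>' (u, S f u)))" for u
  have "linear (\<lambda>u. ?\<Phi>' (u, S f u))" using gf(2) has_derivative_linear by blast
  then have R: "linear R" unfolding R_def[abs_def]
    by (simp add: linear_iff)
  have "u = 0" if u: "u \<in> K" and R0: "R u = 0" for u
  proof -
    have "S f u = S g u" using tangent[OF u] by (simp add: S_def)
    then have "fst (fst (?\<Phi>' (u, S f u))) = 0" "snd (snd (?\<Phi>' (u, S f u))) = 0"
      using Dirichlet_tangent[of _ u] by auto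
    moreover have "fst (snd (?\<Phi>' (u, S f u))) = 0" using R0 by (simp add: R_def)
    \<comment> \<open>With zero \<open>x\<close>- and \<open>y\<close>-components the derivative of
      \<open>\<phi>\<close> is applied to zero, which kills the \<open>Y\<close>-component.\<close>
    moreover from calculation have "snd (fst (?\<Phi>' (u, S f u))) = 0"
      using \<Gamma>_tangent[OF refl, of u] linear_0[OF smooth_on_linear_frechet_derivative[OF \<phi> UNIV_I]]
      by (simp add: zero_prod_def)
    ultimately have "?\<Phi>' (u, S f u) = 0" by (simp add: prod_eq_iff)
    then have "(u, S f u) = 0" by (rule inj\<Phi>)
    then show "u = 0" by (simp add: zero_prod_def)
  qed
  then have "inj_on R K" using linear_injective_on_subspace_0[OF R K] by blast
  moreover have spanK: "span K = K" using K by (simp add: span_eq_iff)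
  ultimately have "dim (R ` K) = dim K" using dim_image_eq[OF R, of K] unfolding spanK by blast
  then show ?thesis using dim_subset_UNIV[of "R ` K"] by simp
qed

theorem proposition3p3:
  fixes M :: "(real ^ 'p) set"
    and \<phi> :: "real ^ 'p \<Rightarrow> (real ^ 'n) \<times> (real ^ 'n) \<Rightarrow> (real ^ 'n) \<times> (real ^ 'n)"
    and xs Xs :: "real ^ 'n"
    and \<mu>s :: "real ^ 'p"
    and zs :: "((real ^ 'n) \<times> (real ^ 'n)) \<times> ((real ^ 'n) \<times> (real ^ 'n))"
    and h :: "real ^ 'p \<Rightarrow> (real ^ 'n) \<times> (real ^ 'n) \<Rightarrow> real"
  assumes "open M"
    and "smooth_symplectic_family M \<phi>"
    and "Dirichlet_singularity M \<phi> xs Xs \<mu>s zs h"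
  shows "\<exists>k \<le> CARD('n). obtainable_with k \<mu>s (fst zs) h"
proof -
  note sing = assms(3)[unfolded Dirichlet_singularity_def]
  have \<mu>s: "\<mu>s \<in> M" and z: "zs \<in> \<Gamma> (\<phi> \<mu>s)" "zs \<in> Dirichlet xs Xs"
    using sing[THEN conjunct1] sing[THEN conjunct2, THEN conjunct1] by simp_all
  from sing[THEN conjunct2, THEN conjunct2] obtain N W \<Psi> U f g where
    "open N \<and> \<mu>s \<in> N \<and> N \<subseteq> M \<and> zs \<in> W \<and> local_symplectomorphism_on W \<Psi> \<and> \<Psi> zs = zs \<and>
      open U \<and> smooth_family_on N U f \<and> smooth_on U g \<and>
      (\<forall>\<mu>\<in>N. \<Psi> ` (\<Gamma> (\<phi> \<mu>) \<inter> W) = exact_form_image (f \<mu>) U) \<and>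
      \<Psi> ` (Dirichlet xs Xs \<inter> W) = exact_form_image g U \<and>
      (\<forall>\<mu>\<in>N. \<forall>q\<in>U. h \<mu> q = f \<mu> q - g q)"
    by (elim exE) (rule that)
  then have N: "open N" "\<mu>s \<in> N"
    and W: "zs \<in> W" "local_symplectomorphism_on W \<Psi>" "\<Psi> zs = zs"
    and U: "open U" and f: "smooth_family_on N U f" and g: "smooth_on U g"
    and imf: "\<And>\<mu>. \<mu> \<in> N \<Longrightarrow> \<Psi> ` (\<Gamma> (\<phi> \<mu>) \<inter> W) = exact_form_image (f \<mu>) U"
    and img: "\<Psi> ` (Dirichlet xs Xs \<inter> W) = exact_form_image g U"
    and h: "\<And>\<mu> q. \<mu> \<in> N \<Longrightarrow> q \<in> U \<Longrightarrow> h \<mu> q = f \<mu> q - g q"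
    by simp_all
  let ?h = "\<lambda>z. h (fst z) (snd z)" and ?q = "fst zs"
  have NU: "open (N \<times> U)" using N(1) U by (rule open_Times)
  have fNU: "smooth_on (N \<times> U) (\<lambda>z. f (fst z) (snd z))"
    using f by (simp add: smooth_family_on_def case_prod_unfold)
  have "smooth_on (N \<times> U) (\<lambda>z. f (fst z) (snd z) - g (snd z))"
    by (intro smooth_on_diff fNU smooth_on_compose[OF g] smooth_on_bounded_linear[OF bounded_linear_snd] NU)
      auto
  then have hNU: "smooth_on (N \<times> U) ?h" by (rule smooth_on_cong) (auto simp: h)
  have f0: "smooth_on U (f \<mu>s)"
    using smooth_on_slice[OF fNU U, of \<mu>s] N(2) by simp
  have "smooth_on (M \<times> UNIV) (\<lambda>z. \<phi> (fst z) (snd z))"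
    using assms(2) by (simp add: smooth_symplectic_family_def smooth_family_on_def case_prod_unfold)
  from smooth_on_slice[OF this open_UNIV, of \<mu>s] have \<phi>: "smooth_on UNIV (\<phi> \<mu>s)" using \<mu>s by simp
  have zs_f: "zs \<in> exact_form_image (f \<mu>s) U" using imf[OF N(2)] z(1) W(1,3) by (metis IntI imageI)
  have zs_g: "zs \<in> exact_form_image g U" using img z(2) W(1,3) by (metis IntI imageI)
  have q: "?q \<in> U" using zs_f by (auto simp: exact_form_image_def)
  have Dh: "frechet_derivative ?h (at (\<mu>s, q)) (0, v)
      = frechet_derivative (f \<mu>s) (at q) v - frechet_derivative g (at q) v" if "q \<in> U" for q v
  proof -
    have "frechet_derivative (\<lambda>q. h \<mu>s q) (at q)
        = (\<lambda>v. frechet_derivative (f \<mu>s) (at q) v - frechet_derivative g (at q) v)"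
      by (rule frechet_derivative_cong_open[OF U that _ has_derivative_diff[OF
              smooth_on_has_derivative[OF f0 that] smooth_on_has_derivative[OF g that]]])
        (simp add: h N(2))
    then show ?thesis using frechet_derivative_slice[OF hNU, of \<mu>s q v] N(2) that by simp
  qed
  \<comment> \<open>As \<open>\<Psi>\<close> fixes \<open>zs\<close>, both graphs pass through
    \<open>zs\<close>, so \<open>f\<close> and \<open>g\<close> have the same gradient
    \<open>snd zs\<close> there and the difference is critical.\<close>
  have "frechet_derivative k (at ?q) v = v \<bullet> snd zs" if "zs \<in> exact_form_image k U" for k v
  proof -
    have "(k has_derivative (\<lambda>v. v \<bullet> snd zs)) (at ?q)"
      using that by (auto simp: exact_form_image_def gderiv_def)
    from frechet_derivative_at[OF this, symmetric] show ?thesis by simp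
  qed
  then have crit: "frechet_derivative ?h (at (\<mu>s, ?q)) (0, v) = 0" for v
    using Dh[OF q] zs_f zs_g by simp
  have zNU: "(\<mu>s, ?q) \<in> N \<times> U" using N(2) q by simp
  have "dim (fibre_hessian_kernel ?h (\<mu>s, ?q)) \<le> DIM(real ^ 'n)"
  proof (rule dim_common_tangent_space[OF \<phi> _ W(1,3) z f0 g imf[OF N(2)] img])
    show "diffeomorphism_onto_open_image W \<Psi>"
      using W(2) by (simp add: local_symplectomorphism_on_def)
    show "subspace (fibre_hessian_kernel ?h (\<mu>s, ?q))"
      by (rule subspace_fibre_hessian_kernel[OF hNU zNU])
    fix u w assume u: "u \<in> fibre_hessian_kernel ?h (\<mu>s, ?q)"
    let ?Df = "\<lambda>q. frechet_derivative (f \<mu>s) (at q) w" and ?Dg = "\<lambda>q. frechet_derivative g (at q) w"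
    \<comment> \<open>The fibre Hessian of \<open>h\<close> is the difference of the Hessians of
      \<open>f\<close> and \<open>g\<close>, so membership in its kernel is the tangency
      condition.\<close>
    have "frechet_derivative (\<lambda>q. frechet_derivative ?h (at (\<mu>s, q)) (0, w)) (at ?q)
        = (\<lambda>u. frechet_derivative ?Df (at ?q) u - frechet_derivative ?Dg (at ?q) u)"
      by (rule frechet_derivative_cong_open[OF U q _ has_derivative_diff[OF
              smooth_on_has_derivative[OF smooth_on_frechet_derivative[OF f0] q]
              smooth_on_has_derivative[OF smooth_on_frechet_derivative[OF g] q]]])
        (simp add: Dh)
    moreover have "frechet_derivative (\<lambda>q. frechet_derivative ?h (at (\<mu>s, q)) (0, w)) (at ?q) u = 0"
      using frechet_derivative_slice[OF smooth_on_frechet_derivative[OF hNU] zNU, of "(0, w)" u] u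
      by (simp add: fibre_hessian_kernel_def del: split_paired_All)
    ultimately show "frechet_derivative ?Df (at ?q) u = frechet_derivative ?Dg (at ?q) u" by simp
  qed
  then have "dim (fibre_hessian_kernel ?h (\<mu>s, ?q)) \<le> CARD('n)" by simp
  then show ?thesis
    using parametric_splitting_lemma[OF hNU zNU crit] le_trans by blast
qed

end
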